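(* Assume the setting of the following context with $M\ge 2$ and $H\neq 0$, and let $a:=\frac13\sum_{j\in\{0,1,+\}}\mathrm{Tr}[\sigma_1\rho_j\sigma_1\rho_j]$ and $|E_{\mathrm m}|:=\|H\|_\infty$ (the largest absolute value of an eigenvalue of $H$). Suppose $$0<\delta t<\frac{\sqrt{3-2a}-1}{2|E_{\mathrm m}|},$$ and set $b:=1-a-2|E_{\mathrm m}|\delta t-2E_{\mathrm m}^2\delta t^2$ (so that $b>0$). Let $0<r_0<1$ and let $r>0$ satisfy $$r^2\le\frac{3r_0^2}{M-1}\cdot\frac{b}{1+b}.$$ Then $$\mathrm{Var}_{\boldsymbol\phi\sim\mathcal D(\bar{\boldsymbol\phi},r)}[C(\boldsymbol\phi)]\ \ge\ \frac{4r^4}{45}\Big(1-\frac{4r^2}{7}\Big)\,(1-r_0^2)^2\,b^2 .$$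
   Context: Setting: $\mathcal H=(\mathbb C^2)^{\otimes n}$, $H$ a Hermitian operator on $\mathcal H$, $\delta t>0$, $\mathcal T(\delta t)=e^{-iH\delta t}$. $|\psi_0\rangle,|\psi_1\rangle$ are orthonormal, $|\psi_+\rangle=(|\psi_0\rangle+|\psi_1\rangle)/\sqrt2$, $\rho_j=|\psi_j\rangle\langle\psi_j|$ for $j\in\{0,1,+\}$. For $n$-qubit Pauli strings $\sigma_1,\dots,\sigma_M$ (Hermitian, $\sigma_i^2=I$) and fixed unitaries $W_1,\dots,W_M$, the parameterized circuit is $U(\boldsymbol\phi)=W_M e^{-i\phi_M\sigma_M}\cdots W_1 e^{-i\phi_1\sigma_1}$, $\boldsymbol\phi\in\mathbb R^M$ (so $e^{-i\phi_1\sigma_1}$ acts first). For fixed $\bar{\boldsymbol\phi}\in\mathbb R^M$, the cost is $C(\boldsymbol\phi)=1-\frac13\sum_{j\in\{0,1,+\}}|\langle\psi_j|U^\dagger(\boldsymbol\phi)\mathcal T(\delta t)U(\bar{\boldsymbol\phi})|\psi_j\rangle|^2$. For $r>0$, $\mathcal D(\bar{\boldsymbol\phi},r)$ is the uniform distribution on the hypercube $\{\boldsymbol\phi:\phi_i\in[\bar\phi_i-r,\bar\phi_i+r]\ \forall i\}$. *)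

theory Defs
  imports "Jordan_Normal_Form.Matrix" "Jordan_Normal_Form.Spectral_Radius"
    "Jordan_Normal_Form.Schur_Decomposition" "HOL-Probability.Probability"
begin

definition mtrace :: "complex mat \<Rightarrow> complex" where
  "mtrace A = (\<Sum>i<dim_row A. A $$ (i, i))"

definition kron :: "complex mat \<Rightarrow> complex mat \<Rightarrow> complex mat" where
  "kron A B = Matrix.mat (dim_row A * dim_row B) (dim_col A * dim_col B)
     (\<lambda>(i, j). A $$ (i div dim_row B, j div dim_col B) * B $$ (i mod dim_row B, j mod dim_col B))"

definition pauliI :: "complex mat" where "pauliI = 1\<^sub>m 2"
definition pauliX :: "complex mat" where "pauliX = mat_of_rows_list 2 [[0, 1], [1, 0]]"
definition pauliY :: "complex mat" where "pauliY = mat_of_rows_list 2 [[0, - \<i>], [\<i>, 0]]"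
definition pauliZ :: "complex mat" where "pauliZ = mat_of_rows_list 2 [[1, 0], [0, -1]]"

definition pauli_string :: "nat \<Rightarrow> complex mat \<Rightarrow> bool" where
  "pauli_string n P \<longleftrightarrow> (\<exists>ps. length ps = n \<and> set ps \<subseteq> {pauliI, pauliX, pauliY, pauliZ}
      \<and> P = foldr kron ps (1\<^sub>m 1))"

definition hermitian :: "complex mat \<Rightarrow> bool" where
  "hermitian A \<longleftrightarrow> square_mat A \<and> mat_adjoint A = A"

definition unitary :: "complex mat \<Rightarrow> bool" where
  "unitary U \<longleftrightarrow> square_mat U \<and> mat_adjoint U * U = 1\<^sub>m (dim_row U)"

definition mat_exp :: "complex mat \<Rightarrow> complex mat" where
  "mat_exp A = Matrix.mat (dim_row A) (dim_col A)
     (\<lambda>(i, j). \<Sum>k. (A ^\<^sub>m k) $$ (i, j) / of_nat (fact k))"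

definition braket :: "complex Matrix.vec \<Rightarrow> complex mat \<Rightarrow> complex Matrix.vec \<Rightarrow> complex" where
  "braket v A w = (A *\<^sub>v w) \<bullet>c v"

definition proj :: "complex Matrix.vec \<Rightarrow> complex mat" where
  "proj v = Matrix.mat (dim_vec v) (dim_vec v) (\<lambda>(i, j). vec_index v i * cnj (vec_index v j))"

definition max_abs_eig :: "complex mat \<Rightarrow> real" where
  "max_abs_eig H = Max (cmod ` spectrum H)"

fun circ :: "nat \<Rightarrow> (nat \<Rightarrow> complex mat) \<Rightarrow> (nat \<Rightarrow> complex mat) \<Rightarrow> (nat \<Rightarrow> real) \<Rightarrow> nat \<Rightarrow> complex mat" where
  "circ d \<sigma> W \<phi> 0 = 1\<^sub>m d"
| "circ d \<sigma> W \<phi> (Suc k) =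
     W (Suc k) * mat_exp ((- \<i> * complex_of_real (\<phi> (Suc k))) \<cdot>\<^sub>m \<sigma> (Suc k)) * circ d \<sigma> W \<phi> k"

definition time_evol :: "complex mat \<Rightarrow> real \<Rightarrow> complex mat" where
  "time_evol H dt = mat_exp ((- \<i> * complex_of_real dt) \<cdot>\<^sub>m H)"

definition psi_plus :: "complex Matrix.vec \<Rightarrow> complex Matrix.vec \<Rightarrow> complex Matrix.vec" where
  "psi_plus \<psi>0 \<psi>1 = complex_of_real (1 / sqrt 2) \<cdot>\<^sub>v (\<psi>0 + \<psi>1)"

definition cost ::
  "nat \<Rightarrow> nat \<Rightarrow> (nat \<Rightarrow> complex mat) \<Rightarrow> (nat \<Rightarrow> complex mat) \<Rightarrow> complex mat \<Rightarrow> real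
    \<Rightarrow> complex Matrix.vec \<Rightarrow> complex Matrix.vec \<Rightarrow> (nat \<Rightarrow> real) \<Rightarrow> (nat \<Rightarrow> real) \<Rightarrow> real" where
  "cost d M \<sigma> W H dt \<psi>0 \<psi>1 \<phi>bar \<phi> =
     1 - 1/3 * (\<Sum>\<psi>\<leftarrow>[\<psi>0, \<psi>1, psi_plus \<psi>0 \<psi>1].
        (cmod (braket \<psi> (mat_adjoint (circ d \<sigma> W \<phi> M) * time_evol H dt * circ d \<sigma> W \<phi>bar M) \<psi>))\<^sup>2)"

definition hypercube_unif :: "nat \<Rightarrow> (nat \<Rightarrow> real) \<Rightarrow> real \<Rightarrow> (nat \<Rightarrow> real) measure" where
  "hypercube_unif M \<phi>bar r =
     PiM {1..M} (\<lambda>i. uniform_measure lborel {\<phi>bar i - r .. \<phi>bar i + r})"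

definition variance_of :: "'a measure \<Rightarrow> ('a \<Rightarrow> real) \<Rightarrow> real" where
  "variance_of D f = integral\<^sup>L D (\<lambda>x. (f x - integral\<^sup>L D f)\<^sup>2)"

end

theory Submission
  imports Defs
begin

text \<open>
  Write the cost as \<open>1 - F\<close>. Since a Pauli string squares to the identity, every gate is
  \<open>cos x - \<i> * sin x * \<sigma>\<close>, so that in each single coordinate \<open>F\<close> is a combination of \<open>1\<close>, \<open>cos (2 * x)\<close> and
  \<open>sin (2 * x)\<close>. By the law of total variance it suffices to bound the mean, over the other coordinates,
  of the variance in the first one, and that variance is at least the squared \<open>cos (2 * x)\<close>-coefficient
  times the variance of \<open>cos (2 * x)\<close>. Twice the coefficient is the difference \<open>G\<close> of the values of
  \<open>F\<close> at \<open>\<phi>bar 1\<close> and at \<open>\<phi>bar 1 + pi / 2\<close>. As \<open>1 + G\<close> is nonnegative, averaging over one further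
  coordinate keeps at least the fraction \<open>1 - r\<^sup>2 / 3\<close> of its value at the centre. At the centre of the
  cube the bound \<open>norm (T *\<^sub>v u - u) \<le> Em * dt\<close> for unit vectors \<open>u\<close>, which follows from diagonalising \<open>H\<close>, gives \<open>G \<ge> b\<close>.
\<close>

subsection \<open>Trigonometric polynomials on a cube\<close>

text \<open>The first coordinate is singled out because its gate acts before everything else: a
  shift by \<open>pi / 2\<close> there only puts \<open>- \<i> \<cdot>\<^sub>m \<sigma> 1\<close> in
  front of the state. At the centre the circuit then cancels, up to the effect of \<open>T\<close>,
  and leaves the overlap of \<psi> with \<open>\<sigma> 1 *\<^sub>v \<psi>\<close>, whose mean
  squared modulus is \<open>a\<close>. Away from the centre \<open>G\<close> may be negative, while
  a fixed fraction of the central value survives averaging only for nonnegative functions. This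
  forces the detour through \<open>1 + G\<close>, and it ties the size of the cube to
  \<open>b / (1 + b)\<close>: the condition on \<open>r\<close> makes
  \<open>(1 - r\<^sup>2 / 3) ^ (M - 1) * (1 + b) - 1\<close> at least
  \<open>(1 - r0\<^sup>2) * b\<close>. With \<open>e = Em * dt\<close>, the central fidelity loses
  at most \<open>e\<^sup>2\<close> and the shifted one exceeds the squared overlap by at most
  \<open>2 * e + e\<^sup>2\<close>; together these are the losses in \<open>b\<close>. The constant
  4 / 45 is the 16 / 45 of the variance of the cosine divided by 4, as \<open>G\<close> is twice the
  coefficient.\<close>

lemma integral_uniform_measure_FTC:
  fixes f F :: "real \<Rightarrow> real"
  assumes "a < b" and "\<And>x. (F has_real_derivative f x) (at x)" and "continuous_on UNIV f"
  shows "integral\<^sup>L (uniform_measure lborel {a..b}) f = (F b - F a) / (b - a)"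
proof -
  have [measurable]: "f \<in> borel_measurable borel"
    using assms(3) by (rule borel_measurable_continuous_onI)
  have "uniform_measure lborel {a..b} = density lborel (\<lambda>x. ennreal (indicator {a..b} x / (b - a)))"
    unfolding uniform_measure_def using assms(1)
    by (intro arg_cong[where f = "density lborel"] ext)
       (auto simp: indicator_def divide_ennreal simp flip: ennreal_1)
  then have "integral\<^sup>L (uniform_measure lborel {a..b}) f
      = (\<integral>x. (indicator {a..b} x / (b - a)) *\<^sub>R f x \<partial>lborel)"
    using assms(1) by (simp add: integral_density)
  also have "\<dots> = (\<integral>x. (f x * indicator {a..b} x) / (b - a) \<partial>lborel)"
    by (simp add: mult.commute)
  also have "\<dots> = (\<integral>x. f x * indicator {a..b} x \<partial>lborel) / (b - a)"
    by (rule integral_divide_zero)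
  also have "(\<integral>x. f x * indicator {a..b} x \<partial>lborel) = F b - F a"
    using assms by (intro integral_FTC_Icc_real) (auto simp: continuous_on_eq_continuous_at)
  finally show ?thesis .
qed

section \<open>Taylor bounds and the variance of the cosine\<close>

lemma nonneg_of_deriv_nonneg:
  fixes g g' :: "real \<Rightarrow> real"
  assumes "\<And>x. (g has_real_derivative g' x) (at x)" "\<And>x. x \<ge> 0 \<Longrightarrow> g' x \<ge> 0" "g 0 = 0" "y \<ge> 0"
  shows "g y \<ge> 0"
  using DERIV_nonneg_imp_nondecreasing[of 0 y g] assms by (metis order.trans)

text \<open>Two integrations of \<open>sin x \<le> x\<close>, passing through
  \<open>cos x \<ge> 1 - x ^ 2 / 2\<close>.\<close>

lemma sin_ge_cubic:
  fixes y :: real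
  assumes "y \<ge> 0"
  shows "sin y \<ge> y - y ^ 3 / 6"
proof -
  have c: "cos x - 1 + x ^ 2 / 2 \<ge> 0" if "x \<ge> 0" for x :: real
    by (rule nonneg_of_deriv_nonneg[where g' = "\<lambda>x. x - sin x"])
       (use that in \<open>auto intro!: derivative_eq_intros simp: sin_x_le_x\<close>)
  have "sin y - y + y ^ 3 / 6 \<ge> 0"
    by (rule nonneg_of_deriv_nonneg[OF _ c])
       (use assms in \<open>auto intro!: derivative_eq_intros\<close>)
  then show ?thesis by simp
qed

text \<open>The variance of \<open>cos (2 * x)\<close> for \<open>x\<close> uniform on \<open>{- r..r}\<close>.\<close>

definition var_cos :: "real \<Rightarrow> real" where
  "var_cos r = 1 / 2 + sin (4 * r) / (8 * r) - (sin (2 * r) / (2 * r))\<^sup>2"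

text \<open>After multiplication by \<open>y\<^sup>2\<close>, with \<open>y = 4 * r\<close>, the difference of both sides and its first three
  derivatives vanish at 0, and its fourth derivative is \<open>y * (sin y - y + y ^ 3 / 6) / 2\<close>.\<close>

lemma var_cos_ge:
  assumes "r > 0"
  shows "var_cos r \<ge> 16 * r ^ 4 / 45 * (1 - 4 * r\<^sup>2 / 7)"
proof -
  define y where "y = 4 * r"
  have 4: "x * sin x / 2 - x ^ 2 / 2 + x ^ 4 / 12 \<ge> 0" if "x \<ge> 0" for x :: real
  proof -
    have "x * (sin x - (x - x ^ 3 / 6)) \<ge> 0"
      using sin_ge_cubic[OF that] that by simp
    then show ?thesis by (simp add: algebra_simps eval_nat_numeral)
  qed
  have 3: "sin x / 2 - x * cos x / 2 - x ^ 3 / 6 + x ^ 5 / 60 \<ge> 0" if "x \<ge> 0" for x :: real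
    by (rule nonneg_of_deriv_nonneg[OF _ 4])
       (use that in \<open>auto intro!: derivative_eq_intros simp: field_simps\<close>)
  have 2: "1 - cos x - x * sin x / 2 - x ^ 4 / 24 + x ^ 6 / 360 \<ge> 0" if "x \<ge> 0" for x :: real
    by (rule nonneg_of_deriv_nonneg[OF _ 3])
       (use that in \<open>auto intro!: derivative_eq_intros simp: field_simps\<close>)
  have 1: "x + x * cos x / 2 - 3 / 2 * sin x - x ^ 5 / 120 + x ^ 7 / 2520 \<ge> 0" if "x \<ge> 0" for x :: real
    by (rule nonneg_of_deriv_nonneg[OF _ 2])
       (use that in \<open>auto intro!: derivative_eq_intros simp: field_simps\<close>)
  have 0: "y ^ 2 / 2 + y * sin y / 2 - 2 + 2 * cos y - y ^ 6 / 720 + y ^ 8 / 20160 \<ge> 0"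
    by (rule nonneg_of_deriv_nonneg[OF _ 1])
       (use assms in \<open>auto intro!: derivative_eq_intros simp: field_simps y_def\<close>)
  \<comment> \<open>Links the squared sine in \<open>var_cos\<close> to the \<open>cos y\<close> of
    the inequality just proved.\<close>
  have cy: "cos y = 1 - 2 * (sin (2 * r))\<^sup>2"
    using cos_double_sin[of "2 * r"] by (simp add: y_def)
  have "16 * r\<^sup>2 * var_cos r = y ^ 2 / 2 + y * sin y / 2 - 2 + 2 * cos y"
    unfolding cy using assms by (simp add: y_def var_cos_def field_simps power2_eq_square)
  moreover have "16 * r\<^sup>2 * (16 * r ^ 4 / 45 * (1 - 4 * r\<^sup>2 / 7)) = y ^ 6 / 720 - y ^ 8 / 20160"
    by (simp add: y_def field_simps eval_nat_numeral)
  ultimately have "16 * r\<^sup>2 * (var_cos r - 16 * r ^ 4 / 45 * (1 - 4 * r\<^sup>2 / 7)) \<ge> 0"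
    using 0 by (simp only: right_diff_distrib)
  then show ?thesis using assms by (simp add: zero_le_mult_iff)
qed

section \<open>Functions that are trigonometric polynomials in a single coordinate\<close>

text \<open>The coefficients may depend in any way on the other coordinates; nothing is asked of
  them, such as measurability, because they are always recovered from values of \<open>f\<close>.
  The frequency 2 is that of the squared modulus of an amplitude linear in \<open>cos x\<close> and
  \<open>sin x\<close>.\<close>

definition trig2 :: "(('i \<Rightarrow> real) \<Rightarrow> real) \<Rightarrow> 'i \<Rightarrow> bool" where
  "trig2 f i \<longleftrightarrow> (\<forall>\<phi>. \<exists>A B C. \<forall>x. f (\<phi>(i := x)) = A + B * cos (2 * x) + C * sin (2 * x))"

text \<open>The span of 1, \<open>cos (2 * x)\<close> and \<open>sin (2 * x)\<close> is translation
  invariant. Centring at the midpoint of an interval makes the sine odd about it, so that it drops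
  out of averages.\<close>

lemma trig2_shift:
  assumes "trig2 f i"
  shows "\<exists>A B C. \<forall>x. f (\<phi>(i := x)) = A + B * cos (2 * (x - c)) + C * sin (2 * (x - c))"
proof -
  from assms obtain A B C where *: "\<forall>x. f (\<phi>(i := x)) = A + B * cos (2 * x) + C * sin (2 * x)"
    unfolding trig2_def by blast
  have "f (\<phi>(i := x)) = A + (B * cos (2 * c) + C * sin (2 * c)) * cos (2 * (x - c))
      + (C * cos (2 * c) - B * sin (2 * c)) * sin (2 * (x - c))" for x
  proof -
    have "2 * x = 2 * (x - c) + 2 * c" by simp
    then have 1: "cos (2 * x) = cos (2 * (x - c)) * cos (2 * c) - sin (2 * (x - c)) * sin (2 * c)"
      and 2: "sin (2 * x) = sin (2 * (x - c)) * cos (2 * c) + cos (2 * (x - c)) * sin (2 * c)"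
      by (metis cos_add, metis sin_add)
    have "A + B * (p * q - s * t) + C * (s * q + p * t)
        = A + (B * q + C * t) * p + (C * q - B * t) * s" for p q s t :: real
      by (simp add: algebra_simps)
    then show ?thesis unfolding *[rule_format] 1 2 .
  qed
  then show ?thesis by blast
qed

lemma trig2_const_fun:
  assumes "\<And>\<phi> x. f (\<phi>(i := x)) = f \<phi>"
  shows "trig2 f i"
  unfolding trig2_def
  by (intro allI, rule exI, rule exI[of _ 0], rule exI[of _ 0]) (simp add: assms)

lemma trig2_add:
  assumes "trig2 f i" "trig2 g i"
  shows "trig2 (\<lambda>\<phi>. f \<phi> + g \<phi>) i"
  unfolding trig2_def
proof
  fix \<phi>
  from assms obtain A B C A' B' C' where
    "\<forall>x. f (\<phi>(i := x)) = A + B * cos (2 * x) + C * sin (2 * x)"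
    "\<forall>x. g (\<phi>(i := x)) = A' + B' * cos (2 * x) + C' * sin (2 * x)"
    unfolding trig2_def by metis
  then have "\<forall>x. f (\<phi>(i := x)) + g (\<phi>(i := x))
      = (A + A') + (B + B') * cos (2 * x) + (C + C') * sin (2 * x)"
    by (simp add: algebra_simps)
  then show "\<exists>A B C. \<forall>x. f (\<phi>(i := x)) + g (\<phi>(i := x)) = A + B * cos (2 * x) + C * sin (2 * x)"
    by blast
qed

lemma trig2_cmult:
  assumes "trig2 f i"
  shows "trig2 (\<lambda>\<phi>. k * f \<phi>) i"
  unfolding trig2_def
proof
  fix \<phi>
  from assms obtain A B C where "\<forall>x. f (\<phi>(i := x)) = A + B * cos (2 * x) + C * sin (2 * x)"
    unfolding trig2_def by metis
  then have "\<forall>x. k * f (\<phi>(i := x)) = k * A + (k * B) * cos (2 * x) + (k * C) * sin (2 * x)"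
    by (simp add: algebra_simps)
  then show "\<exists>A B C. \<forall>x. k * f (\<phi>(i := x)) = A + B * cos (2 * x) + C * sin (2 * x)"
    by blast
qed

lemma trig2_fun_upd:
  assumes "trig2 f i" "i \<noteq> j"
  shows "trig2 (\<lambda>\<phi>. f (\<phi>(j := c))) i"
  using assms unfolding trig2_def by (metis fun_upd_twist)

section \<open>Averages over one interval\<close>

abbreviation centered :: "real \<Rightarrow> real \<Rightarrow> real measure" where
  "centered c r \<equiv> uniform_measure lborel {c - r..c + r}"

lemma prob_space_centered: "r > 0 \<Longrightarrow> prob_space (centered c r)"
  by (intro prob_space_uniform_measure) auto

lemma integral_centered_trig:
  assumes "r > 0"
  shows "integral\<^sup>L (centered c r) (\<lambda>x. A + B * cos (2 * (x - c)) + C * sin (2 * (x - c)))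
    = A + B * (sin (2 * r) / (2 * r))"
  by (subst integral_uniform_measure_FTC[where
        F = "\<lambda>x. A * x + B * sin (2 * (x - c)) / 2 - C * cos (2 * (x - c)) / 2"])
     (use assms in \<open>auto intro!: derivative_eq_intros continuous_intros simp: field_simps\<close>)

text \<open>This is squared mean plus variance. Cosine and sine are uncorrelated since their product
  is odd about \<open>c\<close>, so the variance splits into \<open>B\<^sup>2\<close> times that of
  the cosine and \<open>C\<^sup>2\<close> times the mean of the squared sine.\<close>

lemma integral_centered_trig_square:
  assumes "r > 0"
  shows "integral\<^sup>L (centered c r) (\<lambda>x. (A + B * cos (2 * (x - c)) + C * sin (2 * (x - c)))\<^sup>2)
    = (A + B * (sin (2 * r) / (2 * r)))\<^sup>2 + B\<^sup>2 * var_cos r + C\<^sup>2 * (1 / 2 - sin (4 * r) / (8 * r))"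
proof -
  define F where "F x = A\<^sup>2 * x + B\<^sup>2 * (x / 2 + sin (4 * (x - c)) / 8) + C\<^sup>2 * (x / 2 - sin (4 * (x - c)) / 8)
      + A * B * sin (2 * (x - c)) - A * C * cos (2 * (x - c)) - B * C * (cos (2 * (x - c)))\<^sup>2 / 2" for x
  have d: "(F has_real_derivative (A + B * cos (2 * (x - c)) + C * sin (2 * (x - c)))\<^sup>2) (at x)" for x
  proof -
    define u where "u = 2 * (x - c)"
    have c4: "cos (4 * (x - c)) = (cos u)\<^sup>2 - (sin u)\<^sup>2"
      using cos_double[of u] by (simp add: u_def)
    have h: "1 / 2 + cos (4 * (x - c)) / 2 = (cos u)\<^sup>2" "1 / 2 - cos (4 * (x - c)) / 2 = (sin u)\<^sup>2"
      using sin_cos_squared_add[of u] unfolding c4 by (auto simp: field_simps)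
    have "(F has_real_derivative
        A\<^sup>2 + B\<^sup>2 * (1 / 2 + cos (4 * (x - c)) / 2) + C\<^sup>2 * (1 / 2 - cos (4 * (x - c)) / 2)
        + A * B * (2 * cos u) + A * C * (2 * sin u) + B * C * (2 * cos u * sin u)) (at x)"
      unfolding F_def u_def
      by (rule derivative_eq_intros refl | simp)+
    then show ?thesis
      unfolding h by (simp add: u_def power2_eq_square algebra_simps)
  qed
  have "integral\<^sup>L (centered c r) (\<lambda>x. (A + B * cos (2 * (x - c)) + C * sin (2 * (x - c)))\<^sup>2)
      = (F (c + r) - F (c - r)) / ((c + r) - (c - r))"
    using assms by (intro integral_uniform_measure_FTC d) (auto intro!: continuous_intros)
  also have "\<dots> = (A + B * (sin (2 * r) / (2 * r)))\<^sup>2 + B\<^sup>2 * var_cos r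
      + C\<^sup>2 * (1 / 2 - sin (4 * r) / (8 * r))"
    using assms by (simp add: F_def var_cos_def field_simps power2_eq_square)
  finally show ?thesis .
qed

text \<open>Taking for \<open>A\<close> minus the mean of the cosine isolates \<open>var_cos\<close>
  as the integral of a square. The bound \<open>var_cos_ge\<close> does not yield this, as its
  right-hand side is negative once \<open>r\<^sup>2 > 7 / 4\<close>.\<close>

lemma var_cos_nonneg:
  assumes "r > 0"
  shows "var_cos r \<ge> 0"
proof -
  have "var_cos r = integral\<^sup>L (centered 0 r)
      (\<lambda>x. (- (sin (2 * r) / (2 * r)) + 1 * cos (2 * (x - 0)) + 0 * sin (2 * (x - 0)))\<^sup>2)"
    by (subst integral_centered_trig_square[OF assms]) simp
  also have "\<dots> \<ge> 0" by (rule integral_nonneg_AE) simp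
  finally show ?thesis .
qed

text \<open>The mean \<open>A + B * S\<close> is the combination with weights
  \<open>(1 + S) / 2\<close> and \<open>(1 - S) / 2\<close> of the value \<open>A + B\<close> at the
  centre and the value \<open>A - B\<close> at the opposite point of the period. The second part is
  nonnegative and is dropped; the cubic bound for the sine at \<open>2 * r\<close> gives
  \<open>(1 + S) / 2 \<ge> 1 - r\<^sup>2 / 3\<close>.\<close>

lemma integral_centered_trig2_ge:
  assumes "r > 0" "trig2 f i" "\<And>\<phi>. f \<phi> \<ge> 0"
  shows "integral\<^sup>L (centered c r) (\<lambda>x. f (\<phi>(i := x))) \<ge> (1 - r\<^sup>2 / 3) * f (\<phi>(i := c))"
proof -
  obtain A B C where *: "\<And>x. f (\<phi>(i := x)) = A + B * cos (2 * (x - c)) + C * sin (2 * (x - c))"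
    using trig2_shift[OF assms(2)] by metis
  define S where "S = sin (2 * r) / (2 * r)"
  have fc: "f (\<phi>(i := c)) = A + B" by (simp add: *)
  \<comment> \<open>This point may lie outside the interval of integration, which is why
    \<open>f\<close> has to be nonnegative everywhere.\<close>
  have "f (\<phi>(i := c + pi / 2)) = A - B" by (simp add: *)
  then have nn: "A - B \<ge> 0" "A + B \<ge> 0" using assms(3) fc by metis+
  have S: "S \<le> 1" "S \<ge> 1 - 2 * r\<^sup>2 / 3"
    using assms(1) sin_x_le_x[of "2 * r"] sin_ge_cubic[of "2 * r"]
    by (simp_all add: S_def field_simps eval_nat_numeral)
  have "(1 - r\<^sup>2 / 3) * (A + B) \<le> (1 + S) / 2 * (A + B)"
    using S nn by (intro mult_right_mono) auto
  also have "\<dots> \<le> (1 + S) / 2 * (A + B) + (1 - S) / 2 * (A - B)"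
    using S nn by simp
  also have "\<dots> = A + B * S" by (simp add: field_simps)
  also have "\<dots> = integral\<^sup>L (centered c r) (\<lambda>x. f (\<phi>(i := x)))"
    using integral_centered_trig[OF assms(1)] by (simp add: * S_def)
  finally show ?thesis by (simp add: fc)
qed

section \<open>Averages and variance over the cube\<close>

lemma integrable_integral_fun_upd:
  fixes f :: "('i \<Rightarrow> 'a) \<Rightarrow> real"
  assumes ps: "\<And>j. prob_space (M j)"
    and f[measurable]: "f \<in> borel_measurable (PiM (insert i I) M)" and K: "\<And>\<phi>. \<bar>f \<phi>\<bar> \<le> K"
  shows "integrable (PiM I M) (\<lambda>\<phi>. \<integral>x. f (\<phi>(i := x)) \<partial>M i)"
proof -
  interpret Mi: prob_space "M i" by (rule ps)
  interpret PI: prob_space "PiM I M" by (rule prob_space_PiM) (rule ps)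
  show ?thesis
  proof (rule PI.integrable_const_bound[where B = K])
    have "norm (\<integral>x. f (\<phi>(i := x)) \<partial>M i) \<le> K" for \<phi>
    proof (cases "integrable (M i) (\<lambda>x. f (\<phi>(i := x)))")
      case True
      then have "norm (\<integral>x. f (\<phi>(i := x)) \<partial>M i) \<le> (\<integral>x. K \<partial>M i)"
        using K by (intro order_trans[OF integral_norm_bound] integral_mono) auto
      then show ?thesis by (simp add: Mi.prob_space)
    next
      case False
      \<comment> \<open>The integral of a non-integrable function is 0 by convention, and
        \<open>K\<close> is nonnegative because it bounds an absolute value; so no slice has to be
        shown integrable.\<close>
      then show ?thesis using K[of \<phi>] by (simp add: not_integrable_integral_eq)
    qed
    then show "AE \<phi> in PiM I M. norm (\<integral>x. f (\<phi>(i := x)) \<partial>M i) \<le> K" by simp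
    have "(\<lambda>p. f (case p of (\<phi>, x) \<Rightarrow> \<phi>(i := x))) \<in> borel_measurable (PiM I M \<Otimes>\<^sub>M M i)"
      by (rule measurable_compose[OF measurable_add_dim f])
    then show "(\<lambda>\<phi>. \<integral>x. f (\<phi>(i := x)) \<partial>M i) \<in> borel_measurable (PiM I M)"
      by (intro Mi.borel_measurable_lebesgue_integral) (simp add: case_prod_unfold)
  qed
qed

lemma integral_PiM_centered_trig2_ge:
  fixes c :: "'i \<Rightarrow> real"
  assumes "r > 0" "r\<^sup>2 \<le> 3" "finite I"
    and "f \<in> borel_measurable (PiM I (\<lambda>_. borel))"
    and "\<And>i. i \<in> I \<Longrightarrow> trig2 f i" and "\<And>\<phi>. 0 \<le> f \<phi>" "\<And>\<phi>. f \<phi> \<le> K"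
  shows "integral\<^sup>L (PiM I (\<lambda>i. centered (c i) r)) f \<ge> (1 - r\<^sup>2 / 3) ^ card I * f (restrict c I)"
  using assms(3-)
proof (induction I arbitrary: f rule: finite_induct)
  case empty
  interpret prob_space "PiM {} (\<lambda>i. centered (c i) r)"
    by (rule prob_space_PiM) auto
  \<comment> \<open>The empty product is the point mass at the function that is
    \<open>undefined\<close> everywhere, which is \<open>restrict c {}\<close>.\<close>
  show ?case by (simp add: PiM_empty lebesgue_integral_count_space_finite restrict_def)
next
  case (insert i I)
  let ?M = "\<lambda>i. centered (c i) r"
  have ps: "prob_space (?M i)" for i using assms(1) by (rule prob_space_centered)
  interpret product_sigma_finite ?M
    by (simp add: product_sigma_finite_def ps prob_space_imp_sigma_finite)
  interpret PiI: prob_space "PiM (insert i I) ?M" by (rule prob_space_PiM) (rule ps)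
  interpret PI0: prob_space "PiM I ?M" by (rule prob_space_PiM) (rule ps)
  let ?h = "\<lambda>\<phi>. f (\<phi>(i := c i))"
  have s[simp, measurable_cong]: "sets (PiM J ?M) = sets (PiM J (\<lambda>_. borel))" for J
    by (rule sets_PiM_cong) auto
  have f[measurable]: "f \<in> borel_measurable (PiM (insert i I) (\<lambda>_. borel))" by fact
  have h[measurable]: "?h \<in> borel_measurable (PiM I (\<lambda>_. borel))"
    by (rule measurable_compose[OF _ f]) (rule measurable_fun_upd[where J = I], auto)
  have fi: "integrable (PiM (insert i I) ?M) f"
    by (rule PiI.integrable_const_bound[where B = K]) (use insert.prems in auto)
  have ih: "integrable (PiM I ?M) ?h"
    by (rule PI0.integrable_const_bound[where B = K]) (use insert.prems in auto)
  have "(1 - r\<^sup>2 / 3) ^ card (insert i I) * f (restrict c (insert i I))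
      = (1 - r\<^sup>2 / 3) * ((1 - r\<^sup>2 / 3) ^ card I * ?h (restrict c I))"
  proof -
    have "restrict c (insert i I) = (restrict c I)(i := c i)" by (auto simp: restrict_def)
    with insert.hyps show ?thesis by simp
  qed
  also have "\<dots> \<le> (1 - r\<^sup>2 / 3) * integral\<^sup>L (PiM I ?M) ?h"
  proof (intro mult_left_mono insert.IH h)
    show "trig2 ?h j" if "j \<in> I" for j
      using insert.prems insert.hyps that by (intro trig2_fun_upd) auto
  qed (use insert.prems assms(2) in auto)
  also have "\<dots> = (\<integral>\<phi>. (1 - r\<^sup>2 / 3) * ?h \<phi> \<partial>PiM I ?M)"
    by simp
  also have "\<dots> \<le> (\<integral>\<phi>. (\<integral>x. f (\<phi>(i := x)) \<partial>?M i) \<partial>PiM I ?M)"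
  proof (rule integral_mono)
    show "integrable (PiM I ?M) (\<lambda>\<phi>. \<integral>x. f (\<phi>(i := x)) \<partial>?M i)"
      by (rule integrable_integral_fun_upd[where K = K, OF ps]) (use insert.prems in auto)
    show "(1 - r\<^sup>2 / 3) * ?h \<phi> \<le> (\<integral>x. f (\<phi>(i := x)) \<partial>?M i)" for \<phi>
      using insert.prems by (intro integral_centered_trig2_ge assms(1)) auto
  qed (use ih in auto)
  also have "\<dots> = integral\<^sup>L (PiM (insert i I) ?M) f"
    by (rule product_integral_insert[symmetric]) (use insert.hyps fi in auto)
  finally show ?case .
qed

text \<open>Law of total variance: the variance over all coordinates dominates the mean over the coordinates
  in \<open>I\<close> of the variance over coordinate \<open>i\<close>, in which the coefficient of \<open>cos (2 * x)\<close> is half the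
  difference \<open>?G\<close> of two values of \<open>f\<close>.\<close>

lemma variance_PiM_centered_trig2_ge:
  fixes c :: "'i \<Rightarrow> real"
  assumes r: "r > 0" "r\<^sup>2 \<le> 3" and I: "finite I" "i \<notin> I"
    and f[measurable]: "f \<in> borel_measurable (PiM (insert i I) (\<lambda>_. borel))"
    and trig: "\<And>j. j \<in> insert i I \<Longrightarrow> trig2 f j" and f0: "\<And>\<phi>. 0 \<le> f \<phi>" and f1: "\<And>\<phi>. f \<phi> \<le> 1"
    and b: "b \<le> f ((restrict c I)(i := c i)) - f ((restrict c I)(i := c i + pi / 2))"
    and m: "0 \<le> m" "m \<le> (1 - r\<^sup>2 / 3) ^ card I * (1 + b) - 1"
  shows "variance_of (PiM (insert i I) (\<lambda>j. centered (c j) r)) (\<lambda>\<phi>. 1 - f \<phi>) \<ge> var_cos r * (m / 2)\<^sup>2"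
proof -
  let ?M = "\<lambda>j. centered (c j) r"
  let ?G = "\<lambda>\<phi>. f (\<phi>(i := c i)) - f (\<phi>(i := c i + pi / 2))"
  have ps: "prob_space (?M j)" for j using r(1) by (rule prob_space_centered)
  interpret product_sigma_finite ?M
    by (simp add: product_sigma_finite_def ps prob_space_imp_sigma_finite)
  interpret PiI: prob_space "PiM (insert i I) ?M" by (rule prob_space_PiM) (rule ps)
  interpret PI0: prob_space "PiM I ?M" by (rule prob_space_PiM) (rule ps)
  have s[simp, measurable_cong]: "sets (PiM J ?M) = sets (PiM J (\<lambda>_. borel))" for J
    by (rule sets_PiM_cong) auto
  have upd[measurable]: "(\<lambda>\<phi>. f (\<phi>(i := x))) \<in> borel_measurable (PiM I (\<lambda>_. borel))" for x
    by (rule measurable_compose[OF _ f]) (rule measurable_fun_upd[where J = I], auto)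
  have G1: "\<bar>?G \<phi>\<bar> \<le> 1" for \<phi>
    using f0[of "\<phi>(i := c i)"] f1[of "\<phi>(i := c i)"]
      f0[of "\<phi>(i := c i + pi / 2)"] f1[of "\<phi>(i := c i + pi / 2)"] by linarith
  have iG: "integrable (PiM I ?M) ?G"
    by (rule PI0.integrable_const_bound[where B = 1]) (use G1 in auto)
  have iG2: "integrable (PiM I ?M) (\<lambda>\<phi>. (?G \<phi>)\<^sup>2)"
    by (rule PI0.integrable_const_bound[where B = 1]) (use G1 in \<open>auto simp: abs_square_le_1\<close>)

  have mean: "m \<le> (\<integral>\<phi>. ?G \<phi> \<partial>PiM I ?M)"
  proof -
    have "(1 - r\<^sup>2 / 3) ^ card I * (1 + ?G (restrict c I)) \<le> (\<integral>\<phi>. 1 + ?G \<phi> \<partial>PiM I ?M)"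
    proof (rule integral_PiM_centered_trig2_ge[OF r I(1), where K = 2])
      show "trig2 (\<lambda>\<phi>. 1 + ?G \<phi>) j" if "j \<in> I" for j
      proof -
        have "trig2 (\<lambda>\<phi>. f (\<phi>(i := x))) j" for x
          using trig that I by (intro trig2_fun_upd) auto
        then have "trig2 (\<lambda>\<phi>. 1 + (f (\<phi>(i := c i)) + (- 1) * f (\<phi>(i := c i + pi / 2)))) j"
          by (intro trig2_add trig2_cmult) (auto intro: trig2_const_fun)
        then show ?thesis by simp
      qed
      show "0 \<le> 1 + ?G \<phi>" "1 + ?G \<phi> \<le> 2" for \<phi>
        using G1[of \<phi>] by linarith+
    qed measurable
    moreover have "(1 - r\<^sup>2 / 3) ^ card I * (1 + b) \<le> (1 - r\<^sup>2 / 3) ^ card I * (1 + ?G (restrict c I))"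
      using b r(2) by (intro mult_left_mono) auto
    moreover have "(\<integral>\<phi>. 1 + ?G \<phi> \<partial>PiM I ?M) = 1 + (\<integral>\<phi>. ?G \<phi> \<partial>PiM I ?M)"
      using iG by (subst Bochner_Integration.integral_add) (auto simp: PI0.prob_space)
    ultimately show ?thesis using m(2) by linarith
  qed

  define C where "C = (\<lambda>\<phi>. 1 - f \<phi>)"
  define \<mu> where "\<mu> = integral\<^sup>L (PiM (insert i I) ?M) C"
  have C: "0 \<le> C \<phi>" "C \<phi> \<le> 1" for \<phi> using f0[of \<phi>] f1[of \<phi>] by (auto simp: C_def)
  have Cm[measurable]: "C \<in> borel_measurable (PiM (insert i I) (\<lambda>_. borel))"
    unfolding C_def by measurable
  have C2: "\<bar>(C \<phi> - \<mu>)\<^sup>2\<bar> \<le> (1 + \<bar>\<mu>\<bar>)\<^sup>2" for \<phi>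
  proof -
    have "\<bar>C \<phi> - \<mu>\<bar> \<le> \<bar>1 + \<bar>\<mu>\<bar>\<bar>" using C[of \<phi>] by linarith
    then show ?thesis by (simp only: abs_le_square_iff abs_power2)
  qed
  have iC: "integrable (PiM (insert i I) ?M) (\<lambda>\<phi>. (C \<phi> - \<mu>)\<^sup>2)"
    by (rule PiI.integrable_const_bound[where B = "(1 + \<bar>\<mu>\<bar>)\<^sup>2"]) (use C2 in auto)
  \<comment> \<open>The second moment about any constant is at least the variance, so the global
    mean \<mu> can stay in place of the conditional one: it enters only the first square of the
    integral formula, and that square is dropped together with the sine term.\<close>
  have cond: "(?G \<phi> / 2)\<^sup>2 * var_cos r \<le> (\<integral>x. (C (\<phi>(i := x)) - \<mu>)\<^sup>2 \<partial>?M i)" for \<phi>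
  proof -
    have "trig2 f i" using trig by auto
    then obtain A B D where
      *: "\<And>x. f (\<phi>(i := x)) = A + B * cos (2 * (x - c i)) + D * sin (2 * (x - c i))"
      using trig2_shift[of f i \<phi> "c i"] by metis
    have "?G \<phi> = 2 * B" by (simp add: *)
    moreover have "(\<integral>x. (C (\<phi>(i := x)) - \<mu>)\<^sup>2 \<partial>?M i) = (\<integral>x. ((1 - A - \<mu>) + (- B) * cos (2 * (x - c i))
        + (- D) * sin (2 * (x - c i)))\<^sup>2 \<partial>?M i)"
      by (simp add: C_def * algebra_simps)
    moreover have "\<dots> \<ge> B\<^sup>2 * var_cos r"
    proof -
      have "sin (4 * r) / (8 * r) \<le> 1 / 2"
        using r(1) sin_x_le_x[of "4 * r"] by (simp add: field_simps)
      then show ?thesis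
        by (subst integral_centered_trig_square[OF r(1)]) simp
    qed
    ultimately show ?thesis by simp
  qed
  have "var_cos r * (m / 2)\<^sup>2 \<le> var_cos r * ((\<integral>\<phi>. ?G \<phi> \<partial>PiM I ?M) / 2)\<^sup>2"
    using mean m(1) var_cos_nonneg[OF r(1)] by (intro mult_left_mono power_mono) auto
  also have "\<dots> \<le> var_cos r * ((\<integral>\<phi>. (?G \<phi>)\<^sup>2 \<partial>PiM I ?M) / 4)"
  proof -
    \<comment> \<open>Jensen's inequality for the square, read off from a nonnegative
      variance.\<close>
    have "0 \<le> PI0.variance ?G" by (rule PI0.variance_positive)
    also have "\<dots> = (\<integral>\<phi>. (?G \<phi>)\<^sup>2 \<partial>PiM I ?M) - (\<integral>\<phi>. ?G \<phi> \<partial>PiM I ?M)\<^sup>2"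
      by (rule PI0.variance_eq[OF iG iG2])
    finally show ?thesis
      using var_cos_nonneg[OF r(1)] by (intro mult_left_mono) (auto simp: power_divide)
  qed
  also have "\<dots> = (\<integral>\<phi>. (?G \<phi> / 2)\<^sup>2 * var_cos r \<partial>PiM I ?M)"
    by (simp add: power_divide)
  also have "\<dots> \<le> (\<integral>\<phi>. (\<integral>x. (C (\<phi>(i := x)) - \<mu>)\<^sup>2 \<partial>?M i) \<partial>PiM I ?M)"
  proof (rule integral_mono)
    show "integrable (PiM I ?M) (\<lambda>\<phi>. (?G \<phi> / 2)\<^sup>2 * var_cos r)"
      using iG2 by (simp add: power_divide)
    show "integrable (PiM I ?M) (\<lambda>\<phi>. \<integral>x. (C (\<phi>(i := x)) - \<mu>)\<^sup>2 \<partial>?M i)"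
      by (rule integrable_integral_fun_upd[OF ps _ C2]) measurable
  qed (rule cond)
  also have "\<dots> = (\<integral>\<phi>. (C \<phi> - \<mu>)\<^sup>2 \<partial>PiM (insert i I) ?M)"
    by (rule product_integral_insert[OF I iC, symmetric])
  finally show ?thesis
    unfolding variance_of_def \<mu>_def C_def .
qed

subsection \<open>Complex matrices\<close>

lemma cscalar_prod_sum:
  assumes "w \<in> carrier_vec d"
  shows "v \<bullet>c w = (\<Sum>i<d. vec_index v i * cnj (vec_index w i))"
  using assms by (auto simp: scalar_prod_def lessThan_atLeast0 intro!: sum.cong)

lemma mult_mat_vec_sum:
  assumes "A \<in> carrier_mat n m" "v \<in> carrier_vec m" "i < n"
  shows "vec_index (A *\<^sub>v v) i = (\<Sum>j<m. A $$ (i, j) * vec_index v j)"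
  using assms by (auto simp: scalar_prod_def lessThan_atLeast0 intro!: sum.cong)

lemma mult_mat_sum:
  assumes "A \<in> carrier_mat n m" "B \<in> carrier_mat m k" "i < n" "j < k"
  shows "(A * B) $$ (i, j) = (\<Sum>l<m. A $$ (i, l) * B $$ (l, j))"
  using assms by (auto simp: scalar_prod_def lessThan_atLeast0 intro!: sum.cong)

lemma mat_adjoint_carrier[simp]:
  "A \<in> carrier_mat n m \<Longrightarrow> mat_adjoint A \<in> carrier_mat m n"
  by (auto simp: mat_adjoint_def)

lemma mat_adjoint_index:
  fixes A :: "complex mat"
  assumes "A \<in> carrier_mat n m" "i < m" "j < n"
  shows "mat_adjoint A $$ (i, j) = cnj (A $$ (j, i))"
  using assms by (auto simp: mat_adjoint_def mat_of_rows_index)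

lemma cscalar_prod_mult_mat_vec:
  fixes A :: "complex mat"
  assumes A: "A \<in> carrier_mat d d" and v: "v \<in> carrier_vec d" and w: "w \<in> carrier_vec d"
  shows "(A *\<^sub>v v) \<bullet>c w = v \<bullet>c (mat_adjoint A *\<^sub>v w)"
proof -
  have A': "mat_adjoint A \<in> carrier_mat d d" using A by simp
  have "(A *\<^sub>v v) \<bullet>c w = (\<Sum>i<d. \<Sum>j<d. A $$ (i, j) * vec_index v j * cnj (vec_index w i))"
    by (simp add: cscalar_prod_sum[OF w] mult_mat_vec_sum[OF A v] sum_distrib_right
        del: index_mult_mat_vec)
  also have "\<dots> = (\<Sum>j<d. \<Sum>i<d. A $$ (i, j) * vec_index v j * cnj (vec_index w i))"
    by (rule sum.swap)
  also have "\<dots> = (\<Sum>j<d. vec_index v j * cnj (vec_index (mat_adjoint A *\<^sub>v w) j))"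
    by (simp add: mult_mat_vec_sum[OF A' w] mat_adjoint_index[OF A] sum_distrib_left ac_simps
        del: index_mult_mat_vec)
  also have "\<dots> = v \<bullet>c (mat_adjoint A *\<^sub>v w)"
    by (rule cscalar_prod_sum[symmetric]) (use A' w in auto)
  finally show ?thesis .
qed

subsection \<open>Pauli strings\<close>

text \<open>Division with remainder by \<open>b\<close> is a bijection from the indices below
  \<open>a * b\<close> to pairs; this is how \<open>kron\<close> numbers its rows and
  columns.\<close>

lemma sum_lessThan_mult:
  fixes f :: "nat \<Rightarrow> nat \<Rightarrow> 'a :: comm_monoid_add"
  shows "(\<Sum>k<a * b. f (k div b) (k mod b)) = (\<Sum>i<a. \<Sum>j<b. f i j)"
proof (cases "b = 0")
  case False
  have "(\<Sum>k<a * b. f (k div b) (k mod b)) = (\<Sum>(i, j)\<in>{..<a} \<times> {..<b}. f i j)"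
  proof (rule sum.reindex_bij_witness[of _ "\<lambda>(i, j). i * b + j" "\<lambda>k. (k div b, k mod b)"])
    fix p assume "p \<in> {..<a} \<times> {..<b}"
    then obtain i j where p: "p = (i, j)" "i < a" "j < b" by auto
    have "i * b + j < (i + 1) * b" using p by simp
    also have "\<dots> \<le> a * b" using p by (intro mult_right_mono) auto
    finally show "(case p of (i, j) \<Rightarrow> i * b + j) \<in> {..<a * b}" using p by simp
    show "((case p of (i, j) \<Rightarrow> i * b + j) div b, (case p of (i, j) \<Rightarrow> i * b + j) mod b) = p"
      using p by auto
  qed (use False in \<open>auto simp: less_mult_imp_div_less\<close>)
  then show ?thesis by (simp add: sum.cartesian_product)
qed simp

lemma kron_carrier:
  "A \<in> carrier_mat a a \<Longrightarrow> B \<in> carrier_mat b b \<Longrightarrow> kron A B \<in> carrier_mat (a * b) (a * b)"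
  by (auto simp: kron_def)

lemma kron_index:
  assumes "A \<in> carrier_mat a a" "B \<in> carrier_mat b b" "i < a * b" "j < a * b"
  shows "kron A B $$ (i, j) = A $$ (i div b, j div b) * B $$ (i mod b, j mod b)"
  using assms by (auto simp: kron_def)

lemma kron_mult:
  assumes A: "A \<in> carrier_mat a a" and B: "B \<in> carrier_mat b b"
    and C: "C \<in> carrier_mat a a" and D: "D \<in> carrier_mat b b"
  shows "kron A B * kron C D = kron (A * C) (B * D)"
proof (rule eq_matI)
  note AB = kron_carrier[OF A B] and CD = kron_carrier[OF C D]
  have AC: "A * C \<in> carrier_mat a a" and BD: "B * D \<in> carrier_mat b b" using assms by auto
  note ACBD = kron_carrier[OF AC BD]
  show "dim_row (kron A B * kron C D) = dim_row (kron (A * C) (B * D))"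
    "dim_col (kron A B * kron C D) = dim_col (kron (A * C) (B * D))"
    using AB CD ACBD by auto
  fix i j assume "i < dim_row (kron (A * C) (B * D))" "j < dim_col (kron (A * C) (B * D))"
  then have ij: "i < a * b" "j < a * b" using ACBD by auto
  then have b: "b > 0" by (metis gr0I mult_0_right not_less0)
  have dm: "i div b < a" "j div b < a" "i mod b < b" "j mod b < b"
    using ij b by (auto simp: less_mult_imp_div_less)
  have "(kron A B * kron C D) $$ (i, j) = (\<Sum>k<a * b. kron A B $$ (i, k) * kron C D $$ (k, j))"
    by (rule mult_mat_sum[OF AB CD ij])
  also have "\<dots> = (\<Sum>k<a * b. A $$ (i div b, k div b) * B $$ (i mod b, k mod b) *
      (C $$ (k div b, j div b) * D $$ (k mod b, j mod b)))"
    using ij by (intro sum.cong refl) (simp add: kron_index[OF A B] kron_index[OF C D])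
  also have "\<dots> = (\<Sum>k<a. \<Sum>l<b. A $$ (i div b, k) * B $$ (i mod b, l) *
      (C $$ (k, j div b) * D $$ (l, j mod b)))"
    by (rule sum_lessThan_mult)
  also have "\<dots> = (A * C) $$ (i div b, j div b) * (B * D) $$ (i mod b, j mod b)"
    by (simp add: mult_mat_sum[OF A C dm(1,2)] mult_mat_sum[OF B D dm(3,4)] sum_product ac_simps)
  also have "\<dots> = kron (A * C) (B * D) $$ (i, j)"
    by (rule kron_index[OF AC BD ij, symmetric])
  finally show "(kron A B * kron C D) $$ (i, j) = kron (A * C) (B * D) $$ (i, j)" .
qed

lemma kron_one: "kron (1\<^sub>m a) (1\<^sub>m b) = 1\<^sub>m (a * b)"
proof (rule eq_matI)
  fix i j assume "i < dim_row (1\<^sub>m (a * b) :: complex mat)" "j < dim_col (1\<^sub>m (a * b) :: complex mat)"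
  then have ij: "i < a * b" "j < a * b" by auto
  then have b: "b > 0" by (metis gr0I mult_0_right not_less0)
  have "i div b = j div b \<and> i mod b = j mod b \<longleftrightarrow> i = j"
    by (metis div_mult_mod_eq)
  then show "kron (1\<^sub>m a) (1\<^sub>m b) $$ (i, j) = 1\<^sub>m (a * b) $$ (i, j)"
    using ij b by (auto simp: kron_def less_mult_imp_div_less)
qed (auto simp: kron_def)

lemma mat_adjoint_kron:
  assumes A: "A \<in> carrier_mat a a" and B: "B \<in> carrier_mat b b"
  shows "mat_adjoint (kron A B) = kron (mat_adjoint A) (mat_adjoint B)"
proof (rule eq_matI)
  have A': "mat_adjoint A \<in> carrier_mat a a" and B': "mat_adjoint B \<in> carrier_mat b b"
    using A B by auto
  note AB = kron_carrier[OF A B] and AB' = kron_carrier[OF A' B']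
  show "dim_row (mat_adjoint (kron A B)) = dim_row (kron (mat_adjoint A) (mat_adjoint B))"
    "dim_col (mat_adjoint (kron A B)) = dim_col (kron (mat_adjoint A) (mat_adjoint B))"
    using mat_adjoint_carrier[OF AB] AB' by (metis carrier_matD)+
  fix i j
  assume "i < dim_row (kron (mat_adjoint A) (mat_adjoint B))" "j < dim_col (kron (mat_adjoint A) (mat_adjoint B))"
  then have ij: "i < a * b" "j < a * b" using AB' by auto
  then have b: "b > 0" by (metis gr0I mult_0_right not_less0)
  have dm: "i div b < a" "j div b < a" "i mod b < b" "j mod b < b"
    using ij b by (auto simp: less_mult_imp_div_less)
  show "mat_adjoint (kron A B) $$ (i, j) = kron (mat_adjoint A) (mat_adjoint B) $$ (i, j)"
    using ij dm by (simp add: mat_adjoint_index[OF AB] kron_index[OF A B] kron_index[OF A' B']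
        mat_adjoint_index[OF A] mat_adjoint_index[OF B])
qed

lemma pauli_matrix:
  assumes "P \<in> {pauliI, pauliX, pauliY, pauliZ}"
  shows "P \<in> carrier_mat 2 2" "mat_adjoint P = P" "P * P = 1\<^sub>m 2"
proof -
  show P: "P \<in> carrier_mat 2 2"
    using assms by (auto simp: pauliI_def pauliX_def pauliY_def pauliZ_def mat_of_rows_list_def)
  show "mat_adjoint P = P"
  proof (rule eq_matI)
    fix i j assume "i < dim_row P" "j < dim_col P"
    then have ij: "i < 2" "j < 2" using P by auto
    then have "i \<in> {0, 1}" "j \<in> {0, 1}" by auto
    then show "mat_adjoint P $$ (i, j) = P $$ (i, j)"
      unfolding mat_adjoint_index[OF P ij]
      using assms by (auto simp: pauliI_def pauliX_def pauliY_def pauliZ_def mat_of_rows_list_def)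
  qed (use P in \<open>auto simp: mat_adjoint_def\<close>)
  show "P * P = 1\<^sub>m 2"
  proof (rule eq_matI)
    fix i j assume "i < dim_row (1\<^sub>m 2 :: complex mat)" "j < dim_col (1\<^sub>m 2 :: complex mat)"
    then have ij: "i < 2" "j < 2" by auto
    then have "i \<in> {0, 1}" "j \<in> {0, 1}" by auto
    then show "(P * P) $$ (i, j) = 1\<^sub>m 2 $$ (i, j)"
      unfolding mult_mat_sum[OF P P ij] lessThan_nat_numeral
      using assms by (auto simp: pauliI_def pauliX_def pauliY_def pauliZ_def mat_of_rows_list_def)
  qed (use P in auto)
qed

text \<open>All that is used of Pauli strings later on: both identities hold for the four
  single-qubit matrices and pass through \<open>kron\<close> factor by factor, starting from the 1
  by 1 identity.\<close>

lemma pauli_string: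
  assumes "pauli_string n P"
  shows "P \<in> carrier_mat (2 ^ n) (2 ^ n)" "mat_adjoint P = P" "P * P = 1\<^sub>m (2 ^ n)"
proof -
  have c1: "mat_adjoint (1\<^sub>m 1 :: complex mat) \<in> carrier_mat 1 1"
    by (rule mat_adjoint_carrier) (rule one_carrier_mat)
  have adj1: "mat_adjoint (1\<^sub>m 1 :: complex mat) = 1\<^sub>m 1"
    using carrier_matD[OF c1]
    by (intro eq_matI) (auto simp: mat_adjoint_index[of _ 1 1] simp del: One_nat_def)
  have "foldr kron ps (1\<^sub>m 1) \<in> carrier_mat (2 ^ length ps) (2 ^ length ps) \<and>
      mat_adjoint (foldr kron ps (1\<^sub>m 1)) = foldr kron ps (1\<^sub>m 1) \<and>
      foldr kron ps (1\<^sub>m 1) * foldr kron ps (1\<^sub>m 1) = 1\<^sub>m (2 ^ length ps)"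
    if "set ps \<subseteq> {pauliI, pauliX, pauliY, pauliZ}" for ps
    using that
  proof (induction ps)
    case Nil
    show ?case by (simp add: adj1[unfolded One_nat_def])
  next
    case (Cons P ps)
    then have P: "P \<in> {pauliI, pauliX, pauliY, pauliZ}" by simp
    let ?A = "foldr kron ps (1\<^sub>m 1)"
    from Cons have A: "?A \<in> carrier_mat (2 ^ length ps) (2 ^ length ps)" "mat_adjoint ?A = ?A"
      "?A * ?A = 1\<^sub>m (2 ^ length ps)" by auto
    note p = pauli_matrix[OF P]
    show ?case
      using kron_carrier[OF p(1) A(1)] mat_adjoint_kron[OF p(1) A(1)] kron_mult[OF p(1) A(1) p(1) A(1)]
        kron_one[of 2 "2 ^ length ps"]
      by (simp only: foldr.simps o_apply length_Cons power_Suc p A)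
  qed
  with assms show "P \<in> carrier_mat (2 ^ n) (2 ^ n)" "mat_adjoint P = P" "P * P = 1\<^sub>m (2 ^ n)"
    unfolding pauli_string_def by auto
qed

subsection \<open>Exponentials\<close>

lemma pow_smult_involution:
  fixes S :: "complex mat"
  assumes S: "S \<in> carrier_mat d d" and inv: "S * S = 1\<^sub>m d"
  shows "(c \<cdot>\<^sub>m S) ^\<^sub>m k = c ^ k \<cdot>\<^sub>m (if even k then 1\<^sub>m d else S)"
proof (induction k)
  case 0
  show ?case using S by (intro eq_matI) auto
next
  case (Suc k)
  have "(c ^ k \<cdot>\<^sub>m X) * (c \<cdot>\<^sub>m S) = c ^ Suc k \<cdot>\<^sub>m (X * S)" if "X \<in> carrier_mat d d" for X
    using that S by (intro eq_matI) (auto simp: scalar_prod_def sum_distrib_left ac_simps)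
  then show ?case using Suc S inv by auto
qed

text \<open>The matrices \<open>(1 + S) / 2\<close> and \<open>(1 - S) / 2\<close> are complementary
  projections on which the exponent acts as a scalar. Entrywise, the alternation of \<open>u\<close>
  and \<open>s\<close> with the parity of the power is the combination of \<open>?c ^ k\<close> and
  \<open>(- ?c) ^ k\<close> with weights \<open>(u + s) / 2\<close> and \<open>(u - s) / 2\<close>,
  so the series is a sum of two scalar exponential series and need not be split into even and odd
  terms.\<close>

lemma mat_exp_involution:
  fixes S :: "complex mat"
  assumes S: "S \<in> carrier_mat d d" and inv: "S * S = 1\<^sub>m d"
  shows "mat_exp ((- \<i> * complex_of_real x) \<cdot>\<^sub>m S)
    = complex_of_real (cos x) \<cdot>\<^sub>m 1\<^sub>m d + complex_of_real (sin x) \<cdot>\<^sub>m (- \<i> \<cdot>\<^sub>m S)"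
proof (rule eq_matI)
  let ?c = "- \<i> * complex_of_real x"
  let ?R = "complex_of_real (cos x) \<cdot>\<^sub>m 1\<^sub>m d + complex_of_real (sin x) \<cdot>\<^sub>m (- \<i> \<cdot>\<^sub>m S)"
  show "dim_row (mat_exp (?c \<cdot>\<^sub>m S)) = dim_row ?R" "dim_col (mat_exp (?c \<cdot>\<^sub>m S)) = dim_col ?R"
    using S by (auto simp: mat_exp_def)
  fix i j assume "i < dim_row ?R" "j < dim_col ?R"
  then have ij: "i < d" "j < d" using S by auto
  define u where "u = (1\<^sub>m d :: complex mat) $$ (i, j)"
  define s where "s = S $$ (i, j)"
  have "(\<lambda>k. (u + s) / 2 * (?c ^ k /\<^sub>R fact k) + (u - s) / 2 * ((- ?c) ^ k /\<^sub>R fact k))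
      sums ((u + s) / 2 * exp ?c + (u - s) / 2 * exp (- ?c))"
    by (intro sums_add sums_mult exp_converges)
  also have "(\<lambda>k. (u + s) / 2 * (?c ^ k /\<^sub>R fact k) + (u - s) / 2 * ((- ?c) ^ k /\<^sub>R fact k))
      = (\<lambda>k. ((?c \<cdot>\<^sub>m S) ^\<^sub>m k) $$ (i, j) / of_nat (fact k))"
  proof
    fix k
    have "((?c \<cdot>\<^sub>m S) ^\<^sub>m k) $$ (i, j) = ?c ^ k * (if even k then u else s)"
      unfolding pow_smult_involution[OF S inv] using ij S by (auto simp: u_def s_def)
    moreover have "(- ?c) ^ k = (if even k then ?c ^ k else - (?c ^ k))"
      by (auto simp: power_minus_odd power_minus_even)
    moreover have "e * t / of_nat (fact k) = t * (e /\<^sub>R fact k)" for e t :: complex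
      by (simp add: scaleR_conv_of_real divide_inverse mult_ac)
    moreover have "(u + s) / 2 * g + (u - s) / 2 * g = u * g" "(u + s) / 2 * g + (u - s) / 2 * (- g) = s * g"
      for g :: complex
      by (simp_all add: field_simps)
    ultimately show "(u + s) / 2 * (?c ^ k /\<^sub>R fact k) + (u - s) / 2 * ((- ?c) ^ k /\<^sub>R fact k)
        = ((?c \<cdot>\<^sub>m S) ^\<^sub>m k) $$ (i, j) / of_nat (fact k)"
      by (cases "even k") (simp_all only: if_True if_False scaleR_minus_right)
  qed
  finally have sums: "(\<lambda>k. ((?c \<cdot>\<^sub>m S) ^\<^sub>m k) $$ (i, j) / of_nat (fact k))
      sums ((u + s) / 2 * exp ?c + (u - s) / 2 * exp (- ?c))" .
  have "mat_exp (?c \<cdot>\<^sub>m S) $$ (i, j) = (\<Sum>k. ((?c \<cdot>\<^sub>m S) ^\<^sub>m k) $$ (i, j) / of_nat (fact k))"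
    using ij S by (simp add: mat_exp_def)
  also have "\<dots> = (u + s) / 2 * exp ?c + (u - s) / 2 * exp (- ?c)"
    by (rule sums_unique[OF sums, symmetric])
  also have "exp ?c = cos x - \<i> * sin x"
    using exp_Euler[of "- complex_of_real x"] by (simp add: cos_of_real sin_of_real)
  also have "exp (- ?c) = cos x + \<i> * sin x"
    using exp_Euler[of "complex_of_real x"] by (simp add: cos_of_real sin_of_real)
  also have "(u + s) / 2 * (cos x - \<i> * sin x) + (u - s) / 2 * (cos x + \<i> * sin x) = ?R $$ (i, j)"
    using ij S by (auto simp: u_def s_def field_simps)
  finally show "mat_exp (?c \<cdot>\<^sub>m S) $$ (i, j) = ?R $$ (i, j)" .
qed

subsection \<open>Orthonormal eigenvectors of a Hermitian matrix\<close>

text \<open>In a Schur basis, where \<open>H\<close> is upper triangular, take a nonzero element of the set whose last nonzero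
  coordinate is as early as possible: subtracting the matching diagonal entry from \<open>H\<close> must annihilate it.\<close>

lemma invariant_set_has_eigenvector:
  fixes H :: "complex mat"
  assumes H: "H \<in> carrier_mat d d" and S: "S \<subseteq> carrier_vec d"
    and inv: "\<And>v \<mu>. v \<in> S \<Longrightarrow> H *\<^sub>v v - \<mu> \<cdot>\<^sub>v v \<in> S"
    and w: "w \<in> S" "w \<noteq> 0\<^sub>v d"
  shows "\<exists>v \<mu>. v \<in> S \<and> v \<noteq> 0\<^sub>v d \<and> H *\<^sub>v v = \<mu> \<cdot>\<^sub>v v"
proof -
  obtain es where es: "char_poly H = (\<Prod>e\<leftarrow>es. [:- e, 1:])"
    using char_poly_factorized[OF H] by auto
  obtain B P Q where "schur_decomposition H es = (B, P, Q)" by (metis prod_cases3)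
  from schur_decomposition[OF H es this]
  have sim: "similar_mat_wit H B P Q" and B_ut: "upper_triangular B" by auto
  note PQ = similar_mat_witD2[OF H sim]
  have B: "B \<in> carrier_mat d d" and P: "P \<in> carrier_mat d d" and Q: "Q \<in> carrier_mat d d"
    using PQ by auto
  have QH: "Q *\<^sub>v (H *\<^sub>v v) = B *\<^sub>v (Q *\<^sub>v v)" if v: "v \<in> carrier_vec d" for v
  proof -
    have "Q * H = (Q * P) * (B * Q)"
      unfolding PQ(3) using B P Q by (simp add: assoc_mult_mat[of _ d d _ d _ d])
    also have "\<dots> = B * Q" using B Q by (simp add: PQ(2))
    finally show ?thesis using v H B Q by (metis assoc_mult_mat_vec)
  qed
  define supp where "supp v m \<longleftrightarrow> m \<le> d \<and> (\<forall>j. m \<le> j \<and> j < d \<longrightarrow> vec_index (Q *\<^sub>v v) j = 0)" for v m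
  define T where "T m \<longleftrightarrow> (\<exists>v. v \<in> S \<and> v \<noteq> 0\<^sub>v d \<and> supp v m)" for m
  have "T d" using w by (auto simp: T_def supp_def)
  define m where "m = (LEAST m. T m)"
  have "T m" unfolding m_def using \<open>T d\<close> by (rule LeastI)
  then obtain v where v: "v \<in> S" "v \<noteq> 0\<^sub>v d" "supp v m" unfolding T_def by auto
  have vc: "v \<in> carrier_vec d" using v S by auto
  define z where "z = Q *\<^sub>v v"
  have zc: "z \<in> carrier_vec d" using Q vc by (auto simp: z_def)
  have z0: "vec_index z j = 0" if "m \<le> j" "j < d" for j using v(3) that by (auto simp: supp_def z_def)
  \<comment> \<open>Otherwise all Schur coordinates of \<open>v\<close> vanish, and \<open>P\<close>
    recovers \<open>v = 0\<close> from them. So a last nonzero coordinate \<open>l = m - 1\<close>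
    exists.\<close>
  have "m \<noteq> 0"
  proof
    assume "m = 0"
    then have "z = 0\<^sub>v d" using z0 zc by (intro eq_vecI) auto
    then have "P *\<^sub>v z = 0\<^sub>v d" using P by auto
    moreover have "P *\<^sub>v z = v"
      unfolding z_def using P Q vc PQ(1) by (metis assoc_mult_mat_vec one_mult_mat_vec)
    ultimately show False using v(2) by simp
  qed
  then obtain l where l: "m = Suc l" by (cases m) auto
  have ld: "l < d" using v(3) l by (auto simp: supp_def)
  define \<mu> where "\<mu> = B $$ (l, l)"
  define u where "u = H *\<^sub>v v - \<mu> \<cdot>\<^sub>v v"
  have uS: "u \<in> S" unfolding u_def by (rule inv[OF v(1)])
  have Hv: "H *\<^sub>v v \<in> carrier_vec d" using H vc by auto
  have Qu: "Q *\<^sub>v u = B *\<^sub>v z - \<mu> \<cdot>\<^sub>v z"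
    unfolding u_def using Q Hv vc
    by (subst mult_minus_distrib_mat_vec[of _ d d]) (auto simp: QH z_def mult_mat_vec)
  have "supp u l"
    unfolding supp_def
  proof (intro conjI allI impI)
    show "l \<le> d" using ld by simp
    fix j assume j: "l \<le> j \<and> j < d"
    have "vec_index (B *\<^sub>v z) j = (\<Sum>k<d. B $$ (j, k) * vec_index z k)"
      using j by (intro mult_mat_vec_sum[OF B zc]) auto
    \<comment> \<open>In row \<open>j \<ge> l\<close>, triangularity kills the terms with
      \<open>k < j\<close>, and \<open>z\<close> vanishes beyond \<open>l\<close>. Only
      \<open>k = j = l\<close> survives; for \<open>j > l\<close> both sides are 0.\<close>
    also have "\<dots> = (\<Sum>k<d. if k = l then \<mu> * vec_index z j else 0)"
    proof (intro sum.cong refl)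
      fix k assume "k \<in> {..<d}"
      then show "B $$ (j, k) * vec_index z k = (if k = l then \<mu> * vec_index z j else 0)"
        using j z0[of k] z0[of j] upper_triangularD[OF B_ut, of k j] B l
        by (cases "k < l"; cases "k = l"; cases "j = l") (auto simp: \<mu>_def)
    qed
    also have "\<dots> = \<mu> * vec_index z j" using ld by simp
    finally show "vec_index (Q *\<^sub>v u) j = 0" unfolding Qu using j zc by simp
  qed
  moreover have "\<not> T l" using l not_less_Least[of l T] by (simp add: m_def)
  ultimately have "u = 0\<^sub>v d" using uS by (auto simp: T_def)
  have "H *\<^sub>v v = \<mu> \<cdot>\<^sub>v v"
  proof (rule eq_vecI)
    fix i assume i: "i < dim_vec (\<mu> \<cdot>\<^sub>v v)"
    then have "vec_index u i = 0" using \<open>u = 0\<^sub>v d\<close> vc by auto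
    then show "vec_index (H *\<^sub>v v) i = vec_index (\<mu> \<cdot>\<^sub>v v) i" using i vc H by (simp add: u_def)
  qed (use H vc in auto)
  with v show ?thesis by blast
qed

text \<open>The \<open>k\<close> linear conditions are padded with zero rows to a square matrix. Row
  \<open>k\<close> is zero, so the transpose kills \<open>unit_vec d k\<close>; hence the
  determinant is 0 and the matrix has a kernel vector.\<close>

lemma exists_orthogonal_vec:
  fixes u :: "nat \<Rightarrow> complex Matrix.vec"
  assumes "k < d" and u: "\<And>l. l < k \<Longrightarrow> u l \<in> carrier_vec d"
  shows "\<exists>w \<in> carrier_vec d. w \<noteq> 0\<^sub>v d \<and> (\<forall>l<k. w \<bullet>c u l = 0)"
proof -
  define A where "A = Matrix.mat d d (\<lambda>(i, j). if i < k then cnj (vec_index (u i) j) else 0)"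
  have A: "A \<in> carrier_mat d d" by (simp add: A_def)
  have "transpose_mat A *\<^sub>v unit_vec d k = 0\<^sub>v d"
    using assms by (intro eq_vecI) (auto simp: A_def)
  then have "Determinant.det (transpose_mat A) = 0"
    using assms(1) A by (subst det_0_iff_vec_prod_zero[of _ d]) (auto intro!: exI[of _ "unit_vec d k"])
  then have "Determinant.det A = 0" by (simp add: Determinant.det_transpose[OF A])
  then obtain w where w: "w \<in> carrier_vec d" "w \<noteq> 0\<^sub>v d" "A *\<^sub>v w = 0\<^sub>v d"
    using det_0_iff_vec_prod_zero[OF A] by auto
  have "w \<bullet>c u l = 0" if l: "l < k" for l
  proof -
    have "0 = vec_index (A *\<^sub>v w) l" using w(3) l assms(1) by simp
    also have "\<dots> = (\<Sum>j<d. A $$ (l, j) * vec_index w j)"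
      using l assms(1) by (intro mult_mat_vec_sum[OF A w(1)]) auto
    also have "\<dots> = w \<bullet>c u l"
      using l assms(1) by (auto simp: cscalar_prod_sum[OF u[OF l]] A_def intro!: sum.cong)
    finally show ?thesis by simp
  qed
  with w show ?thesis by blast
qed

lemma cscalar_prod_self:
  "v \<bullet>c v = complex_of_real (\<Sum>i<dim_vec v. (cmod (vec_index v i))\<^sup>2)"
  by (subst cscalar_prod_sum[of _ "dim_vec v"]) (auto simp: of_real_sum simp flip: complex_norm_square)

lemma hermitian_cscalar_prod:
  assumes "hermitian H" "H \<in> carrier_mat d d" "v \<in> carrier_vec d" "w \<in> carrier_vec d"
  shows "(H *\<^sub>v v) \<bullet>c w = v \<bullet>c (H *\<^sub>v w)"
  using assms cscalar_prod_mult_mat_vec[of H d v w] by (simp add: hermitian_def)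

lemma cscalar_prod_cnj:
  fixes v w :: "complex Matrix.vec"
  assumes "v \<in> carrier_vec d" "w \<in> carrier_vec d"
  shows "w \<bullet>c v = cnj (v \<bullet>c w)"
  by (simp add: cscalar_prod_sum[OF assms(1)] cscalar_prod_sum[OF assms(2)] mult.commute)

lemma cscalar_prod_smult:
  fixes v w :: "complex Matrix.vec"
  assumes "v \<in> carrier_vec d" "w \<in> carrier_vec d"
  shows "(c \<cdot>\<^sub>v v) \<bullet>c w = c * (v \<bullet>c w)" "v \<bullet>c (c \<cdot>\<^sub>v w) = cnj c * (v \<bullet>c w)"
  using assms by (auto simp: cscalar_prod_sum[of _ d] sum_distrib_left mult_ac)

lemma cscalar_prod_add:
  fixes v w :: "complex Matrix.vec"
  assumes "v \<in> carrier_vec d" "w \<in> carrier_vec d" "x \<in> carrier_vec d"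
  shows "(v + w) \<bullet>c x = v \<bullet>c x + w \<bullet>c x" "x \<bullet>c (v + w) = x \<bullet>c v + x \<bullet>c w"
    "(v - w) \<bullet>c x = v \<bullet>c x - w \<bullet>c x" "x \<bullet>c (v - w) = x \<bullet>c v - x \<bullet>c w"
  using assms by (auto simp: cscalar_prod_sum[of _ d] algebra_simps sum.distrib sum_subtractf)

text \<open>The orthogonal complement of the eigenvectors found so far is nonzero while
  \<open>k < d\<close>, and it is stable under \<open>H\<close> because \<open>H\<close> is
  self-adjoint. So it contains a further eigenvector, which is then normalised. Letting
  \<open>k\<close> grow up to \<open>d\<close> makes the spectral theorem an induction.\<close>

lemma hermitian_orthonormal_eigenvectors:
  fixes H :: "complex mat"
  assumes H: "H \<in> carrier_mat d d" "hermitian H" and "k \<le> d"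
  shows "\<exists>u \<kappa>. (\<forall>l<k. u l \<in> carrier_vec d \<and> H *\<^sub>v u l = \<kappa> l \<cdot>\<^sub>v u l) \<and>
    (\<forall>l<k. \<forall>m<k. u l \<bullet>c u m = (if l = m then 1 else 0))"
  using assms(3)
proof (induction k)
  case (Suc k)
  then obtain u \<kappa> where IH: "\<forall>l<k. u l \<in> carrier_vec d \<and> H *\<^sub>v u l = \<kappa> l \<cdot>\<^sub>v u l"
    "\<forall>l<k. \<forall>m<k. u l \<bullet>c u m = (if l = m then 1 else 0)"
    using Suc_leD by blast
  then have u: "\<And>l. l < k \<Longrightarrow> u l \<in> carrier_vec d"
    and ev: "\<And>l. l < k \<Longrightarrow> H *\<^sub>v u l = \<kappa> l \<cdot>\<^sub>v u l"
    and on: "\<And>l m. l < k \<Longrightarrow> m < k \<Longrightarrow> u l \<bullet>c u m = (if l = m then 1 else 0)"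
    by auto
  define S where "S = {v \<in> carrier_vec d. \<forall>l<k. v \<bullet>c u l = 0}"
  obtain w where w: "w \<in> S" "w \<noteq> 0\<^sub>v d"
    using exists_orthogonal_vec[of k d u] u Suc.prems by (auto simp: S_def)
  have inv: "H *\<^sub>v v - \<mu> \<cdot>\<^sub>v v \<in> S" if "v \<in> S" for v \<mu>
  proof -
    have v: "v \<in> carrier_vec d" "\<And>l. l < k \<Longrightarrow> v \<bullet>c u l = 0" using that by (auto simp: S_def)
    have Hv: "H *\<^sub>v v \<in> carrier_vec d" using H v by auto
    have "(H *\<^sub>v v - \<mu> \<cdot>\<^sub>v v) \<bullet>c u l = 0" if l: "l < k" for l
    proof -
      have "(H *\<^sub>v v - \<mu> \<cdot>\<^sub>v v) \<bullet>c u l = (H *\<^sub>v v) \<bullet>c u l - (\<mu> \<cdot>\<^sub>v v) \<bullet>c u l"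
        using Hv v u[OF l] by (intro cscalar_prod_add(3)[of _ d]) auto
      also have "(H *\<^sub>v v) \<bullet>c u l = v \<bullet>c (\<kappa> l \<cdot>\<^sub>v u l)"
        using hermitian_cscalar_prod[OF H(2,1) v(1) u[OF l]] ev[OF l] by simp
      finally show ?thesis
        using v(2)[OF l] by (simp add: cscalar_prod_smult[OF v(1) u[OF l]])
    qed
    then show ?thesis using Hv v by (auto simp: S_def)
  qed
  obtain v \<mu> where v: "v \<in> S" "v \<noteq> 0\<^sub>v d" "H *\<^sub>v v = \<mu> \<cdot>\<^sub>v v"
    using invariant_set_has_eigenvector[OF H(1) _ inv w] by (auto simp: S_def)
  have vc: "v \<in> carrier_vec d" and vu: "\<And>l. l < k \<Longrightarrow> v \<bullet>c u l = 0" using v(1) by (auto simp: S_def)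
  have uv: "u l \<bullet>c v = 0" if "l < k" for l
    using cscalar_prod_cnj[OF vc u[OF that]] vu[OF that] by simp
  define s where "s = (\<Sum>i<dim_vec v. (cmod (vec_index v i))\<^sup>2)"
  have vv: "v \<bullet>c v = complex_of_real s" unfolding s_def by (rule cscalar_prod_self)
  have "s \<ge> 0" unfolding s_def by (intro sum_nonneg) auto
  moreover have "s \<noteq> 0"
  proof
    assume "s = 0"
    then have "v \<bullet>c v = 0" using vv by simp
    then show False using v(2) vc conjugate_square_eq_0_vec by blast
  qed
  ultimately have s: "s > 0" by simp
  define c where "c = complex_of_real (1 / sqrt s)"
  have cc: "c * (cnj c * complex_of_real s) = 1"
    using s by (simp add: c_def flip: of_real_mult)
  define u' where "u' = u(k := c \<cdot>\<^sub>v v)"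
  define \<kappa>' where "\<kappa>' = \<kappa>(k := \<mu>)"
  have cv: "c \<cdot>\<^sub>v v \<in> carrier_vec d" using vc by simp
  have "H *\<^sub>v (c \<cdot>\<^sub>v v) = \<mu> \<cdot>\<^sub>v (c \<cdot>\<^sub>v v)"
    using H vc v(3) by (simp add: mult_mat_vec smult_smult_assoc mult.commute)
  then have "\<forall>l<Suc k. u' l \<in> carrier_vec d \<and> H *\<^sub>v u' l = \<kappa>' l \<cdot>\<^sub>v u' l"
    using u ev cv by (auto simp: u'_def \<kappa>'_def less_Suc_eq)
  moreover have "u' l \<bullet>c u' m = (if l = m then 1 else 0)" if lm: "l < Suc k" "m < Suc k" for l m
  proof -
    consider "l < k" "m < k" | "l = k" "m < k" | "l < k" "m = k" | "l = k" "m = k" using lm by linarith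
    then show ?thesis
    proof cases
      case 1
      then show ?thesis by (simp add: u'_def on)
    next
      case 2
      then show ?thesis using cscalar_prod_smult(1)[OF vc u[OF 2(2)]] vu by (simp add: u'_def)
    next
      case 3
      then show ?thesis using cscalar_prod_smult(2)[OF u[OF 3(1)] vc] uv by (simp add: u'_def)
    next
      case 4
      then show ?thesis
        using cscalar_prod_smult(1)[OF vc cv, of c] cscalar_prod_smult(2)[OF vc vc, of c] cc
        by (simp add: u'_def vv)
    qed
  qed
  ultimately show ?case by blast
qed auto

subsection \<open>Functions of a Hermitian matrix\<close>

definition vnorm :: "complex Matrix.vec \<Rightarrow> real" where
  "vnorm v = sqrt (Re (v \<bullet>c v))"

lemma vnorm_sq: "(vnorm v)\<^sup>2 = Re (v \<bullet>c v)" "v \<bullet>c v = complex_of_real ((vnorm v)\<^sup>2)" "vnorm v \<ge> 0"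
  by (simp_all add: vnorm_def cscalar_prod_self sum_nonneg)

lemma cscalar_prod_Cauchy_Schwarz:
  assumes v: "v \<in> carrier_vec d" and w: "w \<in> carrier_vec d"
  shows "cmod (v \<bullet>c w) \<le> vnorm v * vnorm w"
proof -
  have L2: "vnorm x = L2_set (\<lambda>i. cmod (vec_index x i)) {..<d}" if "x \<in> carrier_vec d" for x
    using that by (simp add: vnorm_def cscalar_prod_self L2_set_def)
  have "cmod (v \<bullet>c w) \<le> (\<Sum>i<d. \<bar>cmod (vec_index v i)\<bar> * \<bar>cmod (vec_index w i)\<bar>)"
    unfolding cscalar_prod_sum[OF w] by (rule order_trans[OF norm_sum]) (simp add: norm_mult)
  also have "\<dots> \<le> vnorm v * vnorm w"
    unfolding L2[OF v] L2[OF w] by (rule L2_set_mult_ineq)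
  finally show ?thesis .
qed

text \<open>Stated through inner products because only these are ever evaluated; in this form it
  passes to products at once and covers the gates, the fixed unitaries and the time evolution
  alike.\<close>

definition isometry :: "nat \<Rightarrow> complex mat \<Rightarrow> bool" where
  "isometry d U \<longleftrightarrow> U \<in> carrier_mat d d \<and>
    (\<forall>v \<in> carrier_vec d. \<forall>w \<in> carrier_vec d. (U *\<^sub>v v) \<bullet>c (U *\<^sub>v w) = v \<bullet>c w)"

lemma isometry_mult:
  assumes "isometry d A" "isometry d B"
  shows "isometry d (A * B)"
  using assms by (auto simp: isometry_def assoc_mult_mat_vec[of _ d d _ d])

lemma isometry_vnorm:
  assumes "isometry d U" "v \<in> carrier_vec d"
  shows "vnorm (U *\<^sub>v v) = vnorm v"
  using assms by (simp add: isometry_def vnorm_def)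

lemma isometry_unitary:
  assumes U: "U \<in> carrier_mat d d" and "unitary U"
  shows "isometry d U"
  unfolding isometry_def
proof (intro conjI ballI U)
  fix v w :: "complex Matrix.vec" assume v: "v \<in> carrier_vec d" and w: "w \<in> carrier_vec d"
  have "mat_adjoint U *\<^sub>v (U *\<^sub>v w) = (mat_adjoint U * U) *\<^sub>v w"
    using U w by (intro assoc_mult_mat_vec[of _ d d _ d, symmetric]) auto
  also have "\<dots> = w" using assms w by (simp add: unitary_def)
  finally show "(U *\<^sub>v v) \<bullet>c (U *\<^sub>v w) = v \<bullet>c w"
    using cscalar_prod_mult_mat_vec[OF U v, of "U *\<^sub>v w"] U w by simp
qed

locale orthonormal_basis =
  fixes d :: nat and u :: "nat \<Rightarrow> complex Matrix.vec"
  assumes u: "\<And>l. l < d \<Longrightarrow> u l \<in> carrier_vec d"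
    and on: "\<And>l m. l < d \<Longrightarrow> m < d \<Longrightarrow> u l \<bullet>c u m = (if l = m then 1 else 0)"
begin

text \<open>The sum of \<open>f l\<close> times the projection onto \<open>u l\<close>: functional
  calculus in the basis \<open>u\<close>, with the function given on indices instead of
  eigenvalues.\<close>

definition fmat :: "(nat \<Rightarrow> complex) \<Rightarrow> complex mat" where
  "fmat f = Matrix.mat d d (\<lambda>(i, j). \<Sum>l<d. f l * vec_index (u l) i * cnj (vec_index (u l) j))"

lemma fmat_carrier[simp]: "fmat f \<in> carrier_mat d d"
  by (simp add: fmat_def)

lemma fmat_index: "i < d \<Longrightarrow> j < d \<Longrightarrow>
    fmat f $$ (i, j) = (\<Sum>l<d. f l * vec_index (u l) i * cnj (vec_index (u l) j))"
  by (simp add: fmat_def)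

text \<open>Resolution of the identity. Orthonormality says that the matrix \<open>P\<close> with
  columns \<open>u l\<close> has its adjoint as left inverse; for square matrices this is also a
  right inverse.\<close>

lemma fmat_one: "fmat (\<lambda>_. 1) = 1\<^sub>m d"
proof -
  define P where "P = Matrix.mat d d (\<lambda>(i, l). vec_index (u l) i)"
  have P: "P \<in> carrier_mat d d" by (simp add: P_def)
  have P': "mat_adjoint P \<in> carrier_mat d d" using P by simp
  have P_adj: "mat_adjoint P $$ (l, i) = cnj (vec_index (u l) i)" if "l < d" "i < d" for l i
    unfolding mat_adjoint_index[OF P that] using that by (simp add: P_def)
  have "mat_adjoint P * P = 1\<^sub>m d"
  proof (rule eq_matI)
    fix l m assume "l < dim_row (1\<^sub>m d :: complex mat)" "m < dim_col (1\<^sub>m d :: complex mat)"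
    then have lm: "l < d" "m < d" by auto
    have "(mat_adjoint P * P) $$ (l, m) = (\<Sum>i<d. vec_index (u m) i * cnj (vec_index (u l) i))"
      unfolding mult_mat_sum[OF P' P lm]
      by (rule sum.cong) (use lm in \<open>auto simp: P_adj mult.commute\<close>, simp add: P_def)
    also have "\<dots> = u m \<bullet>c u l" by (rule cscalar_prod_sum[OF u[OF lm(1)], symmetric])
    finally show "(mat_adjoint P * P) $$ (l, m) = 1\<^sub>m d $$ (l, m)"
      using lm on[OF lm(2,1)] by simp
  qed (use P carrier_matD[OF P'] in auto)
  then have *: "P * mat_adjoint P = 1\<^sub>m d" by (rule mat_mult_left_right_inverse[OF P' P])
  show ?thesis
  proof (rule eq_matI)
    fix i j assume "i < dim_row (1\<^sub>m d :: complex mat)" "j < dim_col (1\<^sub>m d :: complex mat)"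
    then have ij: "i < d" "j < d" by auto
    have "fmat (\<lambda>_. 1) $$ (i, j) = (\<Sum>l<d. P $$ (i, l) * mat_adjoint P $$ (l, j))"
      unfolding fmat_index[OF ij]
      by (rule sum.cong) (use ij in \<open>auto simp: P_adj\<close>, simp add: P_def)
    also have "\<dots> = 1\<^sub>m d $$ (i, j)"
      unfolding mult_mat_sum[OF P P' ij, symmetric] * ..
    finally show "fmat (\<lambda>_. 1) $$ (i, j) = 1\<^sub>m d $$ (i, j)" .
  qed (auto simp: fmat_def)
qed

lemma fmat_mult_vec:
  assumes v: "v \<in> carrier_vec d" and i: "i < d"
  shows "vec_index (fmat f *\<^sub>v v) i = (\<Sum>l<d. f l * (v \<bullet>c u l) * vec_index (u l) i)"
proof -
  have "vec_index (fmat f *\<^sub>v v) i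
      = (\<Sum>j<d. \<Sum>l<d. f l * vec_index (u l) i * cnj (vec_index (u l) j) * vec_index v j)"
    by (simp add: mult_mat_vec_sum[OF fmat_carrier v i] fmat_index i sum_distrib_right
        del: index_mult_mat_vec)
  also have "\<dots> = (\<Sum>l<d. \<Sum>j<d. f l * vec_index (u l) i * cnj (vec_index (u l) j) * vec_index v j)"
    by (rule sum.swap)
  also have "\<dots> = (\<Sum>l<d. f l * (v \<bullet>c u l) * vec_index (u l) i)"
    by (rule sum.cong) (auto simp: cscalar_prod_sum[OF u] sum_distrib_left sum_distrib_right mult_ac)
  finally show ?thesis .
qed

text \<open>With \<open>f\<close> and \<open>g\<close> constantly 1 this is Parseval's
  identity.\<close>

lemma fmat_cscalar_prod:
  assumes v: "v \<in> carrier_vec d" and w: "w \<in> carrier_vec d"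
  shows "(fmat f *\<^sub>v v) \<bullet>c (fmat g *\<^sub>v w) = (\<Sum>l<d. f l * cnj (g l) * ((v \<bullet>c u l) * cnj (w \<bullet>c u l)))"
proof -
  let ?a = "\<lambda>l. f l * (v \<bullet>c u l)" and ?b = "\<lambda>m. g m * (w \<bullet>c u m)"
  have "(fmat f *\<^sub>v v) \<bullet>c (fmat g *\<^sub>v w)
      = (\<Sum>i<d. (\<Sum>l<d. ?a l * vec_index (u l) i) * cnj (\<Sum>m<d. ?b m * vec_index (u m) i))"
    using w by (subst cscalar_prod_sum[of _ d])
      (auto simp: fmat_mult_vec[OF v] fmat_mult_vec[OF w] intro: mult_mat_vec_carrier[OF fmat_carrier]
        simp del: index_mult_mat_vec)
  also have "\<dots> = (\<Sum>i<d. \<Sum>l<d. \<Sum>m<d. ?a l * cnj (?b m) * (vec_index (u l) i * cnj (vec_index (u m) i)))"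
    by (simp add: sum_product mult_ac)
  also have "\<dots> = (\<Sum>l<d. \<Sum>m<d. \<Sum>i<d. ?a l * cnj (?b m) * (vec_index (u l) i * cnj (vec_index (u m) i)))"
    by (subst sum.swap) (rule sum.cong[OF refl], rule sum.swap)
  also have "\<dots> = (\<Sum>l<d. \<Sum>m<d. ?a l * cnj (?b m) * (u l \<bullet>c u m))"
    by (intro sum.cong refl) (simp add: cscalar_prod_sum[OF u] sum_distrib_left)
  also have "\<dots> = (\<Sum>l<d. \<Sum>m<d. if m = l then ?a l * cnj (?b l) else 0)"
    by (intro sum.cong refl) (auto simp: on)
  also have "\<dots> = (\<Sum>l<d. ?a l * cnj (?b l))" by simp
  finally show ?thesis by (simp add: mult_ac)
qed

lemma fmat_mult: "fmat f * fmat g = fmat (\<lambda>l. f l * g l)"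
proof (rule eq_matI)
  fix i j assume "i < dim_row (fmat (\<lambda>l. f l * g l))" "j < dim_col (fmat (\<lambda>l. f l * g l))"
  then have ij: "i < d" "j < d" by (auto simp: fmat_def)
  have "(fmat f * fmat g) $$ (i, j) = (\<Sum>k<d. (\<Sum>l<d. f l * vec_index (u l) i * cnj (vec_index (u l) k)) *
      (\<Sum>m<d. g m * vec_index (u m) k * cnj (vec_index (u m) j)))"
    unfolding mult_mat_sum[OF fmat_carrier fmat_carrier ij] by (rule sum.cong) (auto simp: fmat_index ij)
  also have "\<dots> = (\<Sum>k<d. \<Sum>l<d. \<Sum>m<d. f l * g m * vec_index (u l) i * cnj (vec_index (u m) j) *
      (vec_index (u m) k * cnj (vec_index (u l) k)))"
    by (simp add: sum_product mult_ac)
  also have "\<dots> = (\<Sum>l<d. \<Sum>m<d. \<Sum>k<d. f l * g m * vec_index (u l) i * cnj (vec_index (u m) j) *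
      (vec_index (u m) k * cnj (vec_index (u l) k)))"
    by (subst sum.swap) (rule sum.cong[OF refl], rule sum.swap)
  also have "\<dots> = (\<Sum>l<d. \<Sum>m<d. f l * g m * vec_index (u l) i * cnj (vec_index (u m) j) * (u m \<bullet>c u l))"
    by (intro sum.cong refl) (simp add: cscalar_prod_sum[OF u] sum_distrib_left)
  also have "\<dots> = (\<Sum>l<d. \<Sum>m<d. if m = l then f l * g l * vec_index (u l) i * cnj (vec_index (u l) j) else 0)"
    by (intro sum.cong refl) (auto simp: on)
  also have "\<dots> = fmat (\<lambda>l. f l * g l) $$ (i, j)" by (simp add: fmat_index ij)
  finally show "(fmat f * fmat g) $$ (i, j) = fmat (\<lambda>l. f l * g l) $$ (i, j)" .
qed (auto simp: fmat_def)

lemma fmat_pow: "fmat f ^\<^sub>m k = fmat (\<lambda>l. f l ^ k)"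
proof (induction k)
  case 0
  have "dim_row (fmat f) = d" by (simp add: fmat_def)
  then show ?case by (simp add: fmat_one)
next
  case (Suc k)
  then show ?case by (simp add: fmat_mult mult.commute)
qed

lemma smult_fmat: "c \<cdot>\<^sub>m fmat f = fmat (\<lambda>l. c * f l)"
  by (rule eq_matI) (auto simp: fmat_def sum_distrib_left mult_ac)

text \<open>Powers act on the coefficients, so each entry of the exponential series is a finite
  combination of scalar exponential series.\<close>

lemma mat_exp_fmat: "mat_exp (fmat f) = fmat (\<lambda>l. exp (f l))"
proof (rule eq_matI)
  fix i j assume "i < dim_row (fmat (\<lambda>l. exp (f l)))" "j < dim_col (fmat (\<lambda>l. exp (f l)))"
  then have ij: "i < d" "j < d" by (auto simp: fmat_def)
  have dim: "dim_row (fmat f) = d" "dim_col (fmat f) = d" by (auto simp: fmat_def)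
  have "(\<lambda>k. \<Sum>l<d. (f l ^ k /\<^sub>R fact k) * (vec_index (u l) i * cnj (vec_index (u l) j)))
      sums (\<Sum>l<d. exp (f l) * (vec_index (u l) i * cnj (vec_index (u l) j)))"
    by (intro sums_sum sums_mult2 exp_converges)
  also have "(\<lambda>k. \<Sum>l<d. (f l ^ k /\<^sub>R fact k) * (vec_index (u l) i * cnj (vec_index (u l) j)))
      = (\<lambda>k. (fmat f ^\<^sub>m k) $$ (i, j) / of_nat (fact k))"
    by (rule ext) (simp add: fmat_pow fmat_index ij sum_distrib_left scaleR_conv_of_real
        divide_inverse mult_ac)
  finally have sums: "(\<lambda>k. (fmat f ^\<^sub>m k) $$ (i, j) / of_nat (fact k))
      sums (\<Sum>l<d. exp (f l) * (vec_index (u l) i * cnj (vec_index (u l) j)))" .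
  have "mat_exp (fmat f) $$ (i, j) = (\<Sum>k. (fmat f ^\<^sub>m k) $$ (i, j) / of_nat (fact k))"
    using ij dim by (simp add: mat_exp_def)
  also have "\<dots> = (\<Sum>l<d. exp (f l) * (vec_index (u l) i * cnj (vec_index (u l) j)))"
    by (rule sums_unique[OF sums, symmetric])
  also have "\<dots> = fmat (\<lambda>l. exp (f l)) $$ (i, j)" by (simp add: fmat_index ij mult_ac)
  finally show "mat_exp (fmat f) $$ (i, j) = fmat (\<lambda>l. exp (f l)) $$ (i, j)" .
qed (auto simp: fmat_def mat_exp_def)

text \<open>The spectral decomposition, obtained by applying \<open>H\<close> to the resolution of
  the identity.\<close>

lemma fmat_eigenvectors:
  assumes H: "H \<in> carrier_mat d d" and ev: "\<And>l. l < d \<Longrightarrow> H *\<^sub>v u l = \<kappa> l \<cdot>\<^sub>v u l"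
  shows "H = fmat \<kappa>"
proof (rule eq_matI)
  fix i j assume "i < dim_row (fmat \<kappa>)" "j < dim_col (fmat \<kappa>)"
  then have ij: "i < d" "j < d" by (auto simp: fmat_def)
  have "H $$ (i, j) = (H * fmat (\<lambda>_. 1)) $$ (i, j)" using H by (simp add: fmat_one)
  also have "\<dots> = (\<Sum>k<d. \<Sum>l<d. H $$ (i, k) * vec_index (u l) k * cnj (vec_index (u l) j))"
    unfolding mult_mat_sum[OF H fmat_carrier ij]
    by (rule sum.cong) (auto simp: fmat_index ij sum_distrib_left mult_ac)
  also have "\<dots> = (\<Sum>l<d. \<Sum>k<d. H $$ (i, k) * vec_index (u l) k * cnj (vec_index (u l) j))"
    by (rule sum.swap)
  also have "\<dots> = (\<Sum>l<d. vec_index (H *\<^sub>v u l) i * cnj (vec_index (u l) j))"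
    by (rule sum.cong) (auto simp: mult_mat_vec_sum[OF H u ij(1)] sum_distrib_right
        simp del: index_mult_mat_vec)
  also have "\<dots> = fmat \<kappa> $$ (i, j)"
    unfolding fmat_index[OF ij] using ij u by (intro sum.cong refl) (auto simp: ev carrier_vecD[OF u])
  finally show "H $$ (i, j) = fmat \<kappa> $$ (i, j)" .
qed (use H in \<open>auto simp: fmat_def\<close>)

end

lemma max_abs_eig_ge:
  assumes "H \<in> carrier_mat d d" "\<kappa> \<in> spectrum H"
  shows "cmod \<kappa> \<le> max_abs_eig H"
  unfolding max_abs_eig_def using assms card_finite_spectrum(1)[OF assms(1)] by (intro Max_ge) auto

text \<open>In an eigenbasis the evolution multiplies coordinate \<open>l\<close> by a phase
  \<open>f l\<close> at distance at most \<open>max_abs_eig H * t\<close> from 1; Parseval turns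
  both facts about the phases into the two claims.\<close>

lemma time_evol_hermitian:
  assumes H: "H \<in> carrier_mat d d" "hermitian H" and t: "t \<ge> 0"
  shows "isometry d (time_evol H t)"
    and "v \<in> carrier_vec d \<Longrightarrow> vnorm (time_evol H t *\<^sub>v v - v) \<le> max_abs_eig H * t * vnorm v"
proof -
  obtain u \<kappa> where *: "\<forall>l<d. u l \<in> carrier_vec d \<and> H *\<^sub>v u l = \<kappa> l \<cdot>\<^sub>v u l"
    "\<forall>l<d. \<forall>m<d. u l \<bullet>c u m = (if l = m then 1 else 0)"
    using hermitian_orthonormal_eigenvectors[OF H, of d] by blast
  interpret orthonormal_basis d u by standard (use * in auto)
  have ev: "\<And>l. l < d \<Longrightarrow> H *\<^sub>v u l = \<kappa> l \<cdot>\<^sub>v u l" using * by auto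
  \<comment> \<open>Comparing the two sides of self-adjointness at \<open>u l\<close> gives the
    eigenvalue and its conjugate.\<close>
  have real: "cnj (\<kappa> l) = \<kappa> l" if l: "l < d" for l
    using hermitian_cscalar_prod[OF H(2,1) u[OF l] u[OF l]] on[OF l l]
    by (simp add: ev[OF l] cscalar_prod_smult[OF u[OF l] u[OF l]])
  have bound: "cmod (\<kappa> l) \<le> max_abs_eig H" if l: "l < d" for l
  proof (rule max_abs_eig_ge[OF H(1)])
    have "u l \<noteq> 0\<^sub>v d" using on[OF l l] by auto
    then show "\<kappa> l \<in> spectrum H"
      using H(1) u[OF l] ev[OF l] by (auto simp: spectrum_def eigenvalue_def eigenvector_def)
  qed
  define f where "f l = exp (- \<i> * complex_of_real t * \<kappa> l)" for l
  have T: "time_evol H t = fmat f"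
    using fmat_eigenvectors[OF H(1) ev] unfolding time_evol_def f_def
    by (simp add: smult_fmat mat_exp_fmat)
  have f: "cmod (f l) = 1" "cmod (f l - 1) \<le> max_abs_eig H * t" if l: "l < d" for l
  proof -
    obtain k where k: "\<kappa> l = complex_of_real k"
      using real[OF l] by (metis Reals_cases Reals_cnj_iff)
    have fl: "f l = iexp (- (t * k))" by (simp add: f_def k mult_ac)
    show "cmod (f l) = 1" unfolding fl by (rule norm_exp_i_times)
    \<comment> \<open>A chord of the unit circle is at most as long as its arc.\<close>
    have "cmod (f l - 1) \<le> \<bar>t * k\<bar>"
      using iexp_approx1[of "- (t * k)" 0] by (simp add: fl)
    also have "\<dots> \<le> max_abs_eig H * t"
      using bound[OF l] t by (simp add: k abs_mult mult.commute mult_left_mono)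
    finally show "cmod (f l - 1) \<le> max_abs_eig H * t" .
  qed
  have ip: "v \<bullet>c w = (\<Sum>l<d. (v \<bullet>c u l) * cnj (w \<bullet>c u l))"
    if "v \<in> carrier_vec d" "w \<in> carrier_vec d" for v w
    using fmat_cscalar_prod[OF that, of "\<lambda>_. 1" "\<lambda>_. 1"] that by (simp add: fmat_one)
  show "isometry d (time_evol H t)"
    unfolding isometry_def T
  proof (intro conjI ballI fmat_carrier)
    fix v w :: "complex Matrix.vec" assume vw: "v \<in> carrier_vec d" "w \<in> carrier_vec d"
    have "f l * cnj (f l) = 1" if "l < d" for l
      using f(1)[OF that] complex_norm_square[of "f l"] by simp
    then show "(fmat f *\<^sub>v v) \<bullet>c (fmat f *\<^sub>v w) = v \<bullet>c w"
      unfolding fmat_cscalar_prod[OF vw] ip[OF vw] by (intro sum.cong refl) auto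
  qed
  show "vnorm (time_evol H t *\<^sub>v v - v) \<le> max_abs_eig H * t * vnorm v" if v: "v \<in> carrier_vec d"
  proof -
    let ?e = "max_abs_eig H * t"
    have "fmat f *\<^sub>v v - v = fmat (\<lambda>l. f l - 1) *\<^sub>v v"
    proof (rule eq_vecI)
      fix i assume "i < dim_vec (fmat (\<lambda>l. f l - 1) *\<^sub>v v)"
      then have i: "i < d" by (auto simp: fmat_def)
      have "vec_index v i = vec_index (fmat (\<lambda>_. 1) *\<^sub>v v) i" using v by (simp add: fmat_one)
      then have vi: "vec_index v i = (\<Sum>l<d. 1 * (v \<bullet>c u l) * vec_index (u l) i)"
        unfolding fmat_mult_vec[OF v i] .
      have "vec_index (fmat f *\<^sub>v v - v) i = vec_index (fmat f *\<^sub>v v) i - vec_index v i"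
        using v i by simp
      also have "\<dots> = vec_index (fmat (\<lambda>l. f l - 1) *\<^sub>v v) i"
        unfolding fmat_mult_vec[OF v i] by (subst vi) (simp add: sum_subtractf[symmetric] algebra_simps)
      finally show "vec_index (fmat f *\<^sub>v v - v) i = vec_index (fmat (\<lambda>l. f l - 1) *\<^sub>v v) i" .
    qed (use v in \<open>auto simp: fmat_def\<close>)
    then have "(vnorm (time_evol H t *\<^sub>v v - v))\<^sup>2
        = Re (\<Sum>l<d. (f l - 1) * cnj (f l - 1) * ((v \<bullet>c u l) * cnj (v \<bullet>c u l)))"
      unfolding T vnorm_sq(1) by (simp only: fmat_cscalar_prod[OF v v])
    also have "\<dots> = (\<Sum>l<d. (cmod (f l - 1))\<^sup>2 * (cmod (v \<bullet>c u l))\<^sup>2)"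
      unfolding complex_norm_square[symmetric] by (simp flip: of_real_power of_real_mult)
    also have "\<dots> \<le> (\<Sum>l<d. ?e\<^sup>2 * (cmod (v \<bullet>c u l))\<^sup>2)"
      using f(2) by (intro sum_mono mult_right_mono power_mono) auto
    also have "\<dots> = ?e\<^sup>2 * Re (\<Sum>l<d. (v \<bullet>c u l) * cnj (v \<bullet>c u l))"
      unfolding complex_norm_square[symmetric] by (simp add: sum_distrib_left flip: of_real_power of_real_mult)
    also have "\<dots> = (?e * vnorm v)\<^sup>2"
      by (simp add: ip[OF v v, symmetric] power_mult_distrib vnorm_sq(1))
    finally have sq: "(vnorm (time_evol H t *\<^sub>v v - v))\<^sup>2 \<le> (?e * vnorm v)\<^sup>2" .
    \<comment> \<open>In dimension 0 the spectrum is empty and its maximum unspecified, but there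
      \<open>vnorm v\<close> is 0.\<close>
    have "?e * vnorm v \<ge> 0"
    proof (cases "d = 0")
      case True
      then show ?thesis using v by (simp add: vnorm_def cscalar_prod_self)
    next
      case False
      then have "0 \<le> max_abs_eig H" using bound[of 0] norm_ge_zero[of "\<kappa> 0"] by linarith
      then show ?thesis using t by (simp add: vnorm_sq)
    qed
    with sq show ?thesis by (rule power2_le_imp_le)
  qed
qed

subsection \<open>The circuit\<close>

lemma smult_mat_mult_vec:
  fixes A :: "complex mat"
  assumes "A \<in> carrier_mat n m" "v \<in> carrier_vec m"
  shows "(c \<cdot>\<^sub>m A) *\<^sub>v v = c \<cdot>\<^sub>v (A *\<^sub>v v)"
  using assms by (intro eq_vecI) (auto simp: scalar_prod_def sum_distrib_left mult_ac)

locale circuit =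
  fixes d M :: nat and \<sigma> W :: "nat \<Rightarrow> complex mat"
  assumes sigma: "\<And>i. i \<in> {1..M} \<Longrightarrow> \<sigma> i \<in> carrier_mat d d"
    and sigma_adj: "\<And>i. i \<in> {1..M} \<Longrightarrow> mat_adjoint (\<sigma> i) = \<sigma> i"
    and sigma_sq: "\<And>i. i \<in> {1..M} \<Longrightarrow> \<sigma> i * \<sigma> i = 1\<^sub>m d"
    and W: "\<And>i. i \<in> {1..M} \<Longrightarrow> isometry d (W i)"
begin

definition gate :: "nat \<Rightarrow> real \<Rightarrow> complex mat" where
  "gate i x = mat_exp ((- \<i> * complex_of_real x) \<cdot>\<^sub>m \<sigma> i)"

abbreviation U :: "(nat \<Rightarrow> real) \<Rightarrow> nat \<Rightarrow> complex mat" where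
  "U \<equiv> circ d \<sigma> W"

lemma gate_eq:
  assumes "i \<in> {1..M}"
  shows "gate i x = complex_of_real (cos x) \<cdot>\<^sub>m 1\<^sub>m d + complex_of_real (sin x) \<cdot>\<^sub>m (- \<i> \<cdot>\<^sub>m \<sigma> i)"
  unfolding gate_def by (rule mat_exp_involution[OF sigma[OF assms] sigma_sq[OF assms]])

lemma U_Suc: "U \<phi> (Suc k) = W (Suc k) * gate (Suc k) (\<phi> (Suc k)) * U \<phi> k"
  by (simp only: circ.simps gate_def)

declare circ.simps(2)[simp del] U_Suc[simp]

lemma sigma_isometry:
  assumes i: "i \<in> {1..M}"
  shows "isometry d (\<sigma> i)"
  using sigma[OF i] by (rule isometry_unitary) (use sigma[OF i] in \<open>simp add: unitary_def sigma_adj[OF i] sigma_sq[OF i]\<close>)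

lemma sigma_cscalar_prod:
  assumes i: "i \<in> {1..M}" and v: "v \<in> carrier_vec d" and w: "w \<in> carrier_vec d"
  shows "(\<sigma> i *\<^sub>v v) \<bullet>c w = v \<bullet>c (\<sigma> i *\<^sub>v w)"
  using cscalar_prod_mult_mat_vec[OF sigma[OF i] v w] by (simp add: sigma_adj[OF i])

lemma gate_carrier: "i \<in> {1..M} \<Longrightarrow> gate i x \<in> carrier_mat d d"
  using sigma[of i] by (simp add: gate_eq)

lemma gate_mult_vec:
  assumes i: "i \<in> {1..M}" and v: "v \<in> carrier_vec d"
  shows "gate i x *\<^sub>v v = complex_of_real (cos x) \<cdot>\<^sub>v v + (- \<i> * complex_of_real (sin x)) \<cdot>\<^sub>v (\<sigma> i *\<^sub>v v)"
proof (rule eq_vecI)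
  note s = sigma[OF i]
  fix k assume "k < dim_vec (complex_of_real (cos x) \<cdot>\<^sub>v v + (- \<i> * complex_of_real (sin x)) \<cdot>\<^sub>v (\<sigma> i *\<^sub>v v))"
  then have k: "k < d" using s by auto
  have "vec_index (gate i x *\<^sub>v v) k = (\<Sum>j<d. gate i x $$ (k, j) * vec_index v j)"
    by (rule mult_mat_vec_sum[OF gate_carrier[OF i] v k])
  also have "\<dots> = (\<Sum>j<d. complex_of_real (cos x) * (1\<^sub>m d $$ (k, j) * vec_index v j)
      + (- \<i> * complex_of_real (sin x)) * (\<sigma> i $$ (k, j) * vec_index v j))"
    using s k by (intro sum.cong refl) (auto simp: gate_eq[OF i] algebra_simps)
  also have "\<dots> = complex_of_real (cos x) * vec_index (1\<^sub>m d *\<^sub>v v) k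
      + (- \<i> * complex_of_real (sin x)) * vec_index (\<sigma> i *\<^sub>v v) k"
    unfolding mult_mat_vec_sum[OF one_carrier_mat v k] mult_mat_vec_sum[OF s v k]
    by (simp only: sum.distrib sum_distrib_left)
  also have "\<dots> = vec_index (complex_of_real (cos x) \<cdot>\<^sub>v v + (- \<i> * complex_of_real (sin x)) \<cdot>\<^sub>v (\<sigma> i *\<^sub>v v)) k"
    using v s k by simp
  finally show "vec_index (gate i x *\<^sub>v v) k
    = vec_index (complex_of_real (cos x) \<cdot>\<^sub>v v + (- \<i> * complex_of_real (sin x)) \<cdot>\<^sub>v (\<sigma> i *\<^sub>v v)) k" .
qed (use sigma[OF i] gate_carrier[OF i, of x] v in auto)

text \<open>The mixed terms cancel because \<open>\<sigma> i\<close> is self-adjoint and the factor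
  \<i> changes sign under conjugation; the rest is \<open>cos\<^sup>2 + sin\<^sup>2\<close>.\<close>

lemma gate_isometry:
  assumes i: "i \<in> {1..M}"
  shows "isometry d (gate i x)"
  unfolding isometry_def
proof (intro conjI ballI gate_carrier[OF i])
  fix v w :: "complex Matrix.vec" assume v: "v \<in> carrier_vec d" and w: "w \<in> carrier_vec d"
  define c s where "c = complex_of_real (cos x)" and "s = complex_of_real (sin x)"
  have cs: "c * c + s * s = 1"
    unfolding c_def s_def of_real_mult[symmetric] of_real_add[symmetric]
    by (simp flip: power2_eq_square)
  have sv: "\<sigma> i *\<^sub>v v \<in> carrier_vec d" "\<sigma> i *\<^sub>v w \<in> carrier_vec d" using sigma[OF i] v w by auto
  have ss: "(\<sigma> i *\<^sub>v v) \<bullet>c (\<sigma> i *\<^sub>v w) = v \<bullet>c w"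
    using sigma_isometry[OF i] v w by (simp add: isometry_def)
  have "(gate i x *\<^sub>v v) \<bullet>c (gate i x *\<^sub>v w)
      = c * (c * (v \<bullet>c w) + \<i> * s * (v \<bullet>c (\<sigma> i *\<^sub>v w)))
        + (- \<i> * s) * (c * (v \<bullet>c (\<sigma> i *\<^sub>v w)) + \<i> * s * (v \<bullet>c w))"
    unfolding gate_mult_vec[OF i v] gate_mult_vec[OF i w] c_def[symmetric] s_def[symmetric]
    using v w sv
    by (simp add: cscalar_prod_add[of _ d] cscalar_prod_smult[of _ d] ss sigma_cscalar_prod[OF i v w])
       (simp add: c_def s_def algebra_simps)
  also have "\<dots> = (c * c + s * s) * (v \<bullet>c w)" by (simp add: algebra_simps)
  finally show "(gate i x *\<^sub>v v) \<bullet>c (gate i x *\<^sub>v w) = v \<bullet>c w" by (simp add: cs)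
qed

lemma U_isometry: "k \<le> M \<Longrightarrow> isometry d (U \<phi> k)"
proof (induction k)
  case 0
  show ?case by (simp add: isometry_def)
next
  case (Suc k)
  then show ?case by (auto intro!: isometry_mult W gate_isometry)
qed

lemma U_carrier: "k \<le> M \<Longrightarrow> U \<phi> k \<in> carrier_mat d d"
  using U_isometry by (simp add: isometry_def)

lemma U_cong: "(\<And>i. i \<in> {1..k} \<Longrightarrow> \<phi> i = \<phi>' i) \<Longrightarrow> U \<phi> k = U \<phi>' k"
  by (induction k) auto

text \<open>Only one factor of the product depends on \<open>x\<close>, linearly in
  \<open>cos x\<close> and \<open>sin x\<close>; fixed matrices on either side preserve this
  form.\<close>

lemma U_trig:
  assumes "i \<in> {1..k}" "k \<le> M"
  shows "\<exists>A \<in> carrier_mat d d. \<exists>B \<in> carrier_mat d d. \<forall>x.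
    U (\<phi>(i := x)) k = complex_of_real (cos x) \<cdot>\<^sub>m A + complex_of_real (sin x) \<cdot>\<^sub>m B"
  using assms
proof (induction k)
  case (Suc k)
  let ?c = "\<lambda>x. complex_of_real (cos x)" and ?s = "\<lambda>x. complex_of_real (sin x)"
  have k: "Suc k \<in> {1..M}" using Suc by auto
  have Wk: "W (Suc k) \<in> carrier_mat d d" using W[OF k] by (simp add: isometry_def)
  have lin1: "X * (a \<cdot>\<^sub>m A + b \<cdot>\<^sub>m B) = a \<cdot>\<^sub>m (X * A) + b \<cdot>\<^sub>m (X * B)"
    if "X \<in> carrier_mat d d" "A \<in> carrier_mat d d" "B \<in> carrier_mat d d"
    for X A B :: "complex mat" and a b
    using that by (simp add: mult_add_distrib_mat[of _ d d _ d] mult_smult_distrib[of _ d d _ d])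
  have lin: "X * (a \<cdot>\<^sub>m A + b \<cdot>\<^sub>m B) * Y = a \<cdot>\<^sub>m (X * A * Y) + b \<cdot>\<^sub>m (X * B * Y)"
    if "X \<in> carrier_mat d d" "Y \<in> carrier_mat d d" "A \<in> carrier_mat d d" "B \<in> carrier_mat d d"
    for X Y A B :: "complex mat" and a b
    using that by (simp add: lin1 add_mult_distrib_mat[of _ d d _ _ d] mult_smult_assoc_mat[of _ d d _ d])
  show ?case
  proof (cases "i = Suc k")
    case True
    have "U (\<phi>(i := x)) k = U \<phi> k" for x by (rule U_cong) (use True in auto)
    then have "U (\<phi>(i := x)) (Suc k) = ?c x \<cdot>\<^sub>m (W (Suc k) * 1\<^sub>m d * U \<phi> k)
        + ?s x \<cdot>\<^sub>m (W (Suc k) * (- \<i> \<cdot>\<^sub>m \<sigma> (Suc k)) * U \<phi> k)" for x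
      using Suc.prems sigma[OF k] Wk True U_carrier[of k \<phi>]
      by (simp add: gate_eq[OF k] lin del: mult_minus_left)
    moreover have "W (Suc k) * 1\<^sub>m d * U \<phi> k \<in> carrier_mat d d"
      "W (Suc k) * (- \<i> \<cdot>\<^sub>m \<sigma> (Suc k)) * U \<phi> k \<in> carrier_mat d d"
      using Wk sigma[OF k] U_carrier[of k \<phi>] Suc.prems by auto
    ultimately show ?thesis by blast
  next
    case False
    then obtain A B where AB: "A \<in> carrier_mat d d" "B \<in> carrier_mat d d"
      "\<And>x. U (\<phi>(i := x)) k = ?c x \<cdot>\<^sub>m A + ?s x \<cdot>\<^sub>m B"
      using Suc by (metis Suc_leD atLeastAtMost_iff le_SucE)
    define G where "G = W (Suc k) * gate (Suc k) (\<phi> (Suc k))"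
    have G: "G \<in> carrier_mat d d" using Wk gate_carrier[OF k] by (auto simp: G_def)
    have "U (\<phi>(i := x)) (Suc k) = ?c x \<cdot>\<^sub>m (G * A) + ?s x \<cdot>\<^sub>m (G * B)" for x
      using False G AB by (simp add: lin1 flip: G_def)
    moreover have "G * A \<in> carrier_mat d d" "G * B \<in> carrier_mat d d" using G AB by auto
    ultimately show ?thesis by blast
  qed
qed simp

text \<open>A quarter turn multiplies the first gate by
  \<open>- \<i> \<cdot>\<^sub>m \<sigma> 1\<close> on the right. As that gate is the rightmost
  factor of the circuit, the new matrix ends up next to the state.\<close>

lemma U_shift:
  assumes "1 \<le> k" "k \<le> M"
  shows "U (\<phi>(1 := \<phi> 1 + pi / 2)) k = U \<phi> k * (- \<i> \<cdot>\<^sub>m \<sigma> 1)"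
  using assms
proof (induction k rule: dec_induct)
  case base
  have 1: "1 \<in> {1..M}" using assms by auto
  note s = sigma[OF 1]
  have W1: "W 1 \<in> carrier_mat d d" using W[OF 1] by (simp add: isometry_def)
  have "gate 1 (x + pi / 2) = gate 1 x * (- \<i> \<cdot>\<^sub>m \<sigma> 1)" for x
  proof -
    have "gate 1 x * (- \<i> \<cdot>\<^sub>m \<sigma> 1)
        = complex_of_real (cos x) \<cdot>\<^sub>m (- \<i> \<cdot>\<^sub>m \<sigma> 1) + complex_of_real (sin x) \<cdot>\<^sub>m ((- \<i> \<cdot>\<^sub>m \<sigma> 1) * (- \<i> \<cdot>\<^sub>m \<sigma> 1))"
      unfolding gate_eq[OF 1] using s
      by (simp add: add_mult_distrib_mat[of _ d d _ _ d] mult_smult_assoc_mat[of _ d d _ d])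
    also have "(- \<i> \<cdot>\<^sub>m \<sigma> 1) * (- \<i> \<cdot>\<^sub>m \<sigma> 1) = (- 1) \<cdot>\<^sub>m 1\<^sub>m d"
    proof -
      have "(- \<i> \<cdot>\<^sub>m \<sigma> 1) * (- \<i> \<cdot>\<^sub>m \<sigma> 1) = - \<i> \<cdot>\<^sub>m (- \<i> \<cdot>\<^sub>m (\<sigma> 1 * \<sigma> 1))"
        using s by (simp add: mult_smult_assoc_mat[of _ d d _ d] mult_smult_distrib[of _ d d _ d])
      then show ?thesis
        unfolding sigma_sq[OF 1] by (intro eq_matI) auto
    qed
    finally show ?thesis
      unfolding gate_eq[OF 1] using s
      by (intro eq_matI) (auto simp: cos_add sin_add)
  qed
  moreover have "U \<phi>' 1 = W 1 * gate 1 (\<phi>' 1)" for \<phi>'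
    using right_mult_one_mat[OF mult_carrier_mat[OF W1 gate_carrier[OF 1]], of "\<phi>' 1"] by simp
  ultimately show ?case
    using s W1 gate_carrier[OF 1] by (simp only: fun_upd_same) (simp add: assoc_mult_mat[of _ d d _ d _ d])
next
  case (step k)
  then have k: "Suc k \<in> {1..M}" by auto
  have Wk: "W (Suc k) \<in> carrier_mat d d" using W[OF k] by (simp add: isometry_def)
  have S: "- \<i> \<cdot>\<^sub>m \<sigma> 1 \<in> carrier_mat d d" using assms by (intro smult_carrier_mat sigma) auto
  have Uk: "U \<phi> k \<in> carrier_mat d d" using step by (intro U_carrier) auto
  show ?case
    using step assoc_mult_mat[OF mult_carrier_mat[OF Wk gate_carrier[OF k]] Uk S] by simp
qed

lemma measurable_U:
  assumes "k \<le> M" "i < d" "j < d"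
  shows "(\<lambda>\<phi>. U \<phi> k $$ (i, j)) \<in> borel_measurable (PiM {1..M} (\<lambda>_. borel))"
  using assms
proof (induction k arbitrary: i j)
  case 0
  then show ?case by simp
next
  case (Suc k)
  have k: "Suc k \<in> {1..M}" using Suc by auto
  have Wk: "W (Suc k) \<in> carrier_mat d d" using W[OF k] by (simp add: isometry_def)
  have [measurable]: "(\<lambda>\<phi>. \<phi> (Suc k)) \<in> borel_measurable (PiM {1..M} (\<lambda>_. borel :: real measure))"
    using k by (rule measurable_component_singleton)
  have g: "(\<lambda>\<phi>. gate (Suc k) (\<phi> (Suc k)) $$ (m, l)) \<in> borel_measurable (PiM {1..M} (\<lambda>_. borel))"
    if "m < d" "l < d" for m l
  proof -
    have "gate (Suc k) x $$ (m, l) = complex_of_real (cos x) * 1\<^sub>m d $$ (m, l)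
        + complex_of_real (sin x) * (- \<i> * \<sigma> (Suc k) $$ (m, l))" for x
      using that sigma[OF k] by (simp add: gate_eq[OF k])
    then show ?thesis by (simp only:) measurable
  qed
  have "U \<phi> (Suc k) $$ (i, j)
      = (\<Sum>l<d. (\<Sum>m<d. W (Suc k) $$ (i, m) * gate (Suc k) (\<phi> (Suc k)) $$ (m, l)) * U \<phi> k $$ (l, j))" for \<phi>
  proof -
    note gc = gate_carrier[OF k, of "\<phi> (Suc k)"]
    have WG: "W (Suc k) * gate (Suc k) (\<phi> (Suc k)) \<in> carrier_mat d d" using Wk gc by auto
    have Uk: "U \<phi> k \<in> carrier_mat d d" using Suc.prems by (intro U_carrier) auto
    show ?thesis
      unfolding U_Suc mult_mat_sum[OF WG Uk Suc.prems(2,3)]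
      by (intro sum.cong refl) (simp add: mult_mat_sum[OF Wk gc Suc.prems(2)] del: index_mult_mat)
  qed
  moreover have "(\<lambda>\<phi>. \<Sum>l<d. (\<Sum>m<d. W (Suc k) $$ (i, m) * gate (Suc k) (\<phi> (Suc k)) $$ (m, l)) * U \<phi> k $$ (l, j))
      \<in> borel_measurable (PiM {1..M} (\<lambda>_. borel))"
    using Suc by (intro borel_measurable_sum borel_measurable_times borel_measurable_const g) auto
  ultimately show ?case by simp
qed

section \<open>Fidelities with a fixed target state\<close>

definition fidelity :: "complex Matrix.vec \<Rightarrow> complex Matrix.vec \<Rightarrow> (nat \<Rightarrow> real) \<Rightarrow> real" where
  "fidelity \<xi> \<psi> \<phi> = (cmod (\<xi> \<bullet>c (U \<phi> M *\<^sub>v \<psi>)))\<^sup>2"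

lemma measurable_fidelity:
  assumes \<xi>: "\<xi> \<in> carrier_vec d" and \<psi>: "\<psi> \<in> carrier_vec d"
  shows "fidelity \<xi> \<psi> \<in> borel_measurable (PiM {1..M} (\<lambda>_. borel))"
proof -
  have "fidelity \<xi> \<psi> \<phi> = (cmod (\<Sum>i<d. (\<Sum>j<d. U \<phi> M $$ (i, j) * vec_index \<psi> j) * cnj (vec_index \<xi> i)))\<^sup>2"
    for \<phi>
  proof -
    note Uc = U_carrier[OF order_refl, of \<phi>]
    have "\<xi> \<bullet>c (U \<phi> M *\<^sub>v \<psi>) = cnj ((U \<phi> M *\<^sub>v \<psi>) \<bullet>c \<xi>)"
      using Uc \<psi> \<xi> by (intro cscalar_prod_cnj[of _ d]) auto
    also have "(U \<phi> M *\<^sub>v \<psi>) \<bullet>c \<xi> = (\<Sum>i<d. (\<Sum>j<d. U \<phi> M $$ (i, j) * vec_index \<psi> j) * cnj (vec_index \<xi> i))"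
      unfolding cscalar_prod_sum[OF \<xi>] by (intro sum.cong refl) (simp only: mult_mat_vec_sum[OF Uc \<psi>] lessThan_iff)
    finally show ?thesis by (simp only: fidelity_def complex_mod_cnj)
  qed
  then have "fidelity \<xi> \<psi>
      = (\<lambda>\<phi>. (cmod (\<Sum>i<d. (\<Sum>j<d. U \<phi> M $$ (i, j) * vec_index \<psi> j) * cnj (vec_index \<xi> i)))\<^sup>2)"
    by (rule ext)
  moreover have "(\<lambda>\<phi>. \<Sum>i<d. (\<Sum>j<d. U \<phi> M $$ (i, j) * vec_index \<psi> j) * cnj (vec_index \<xi> i))
      \<in> borel_measurable (PiM {1..M} (\<lambda>_. borel))"
    by (intro borel_measurable_sum borel_measurable_times borel_measurable_const measurable_U) auto
  ultimately show ?thesis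
    by (simp only:) (intro borel_measurable_power measurable_compose[OF _ borel_measurable_norm])
qed

text \<open>The amplitude is \<open>cos x * \<alpha> + sin x * \<beta>\<close>, conjugation being
  harmless on real coefficients; the double-angle formulas turn its squared modulus into frequency
  2.\<close>

lemma trig2_fidelity:
  assumes \<xi>: "\<xi> \<in> carrier_vec d" and \<psi>: "\<psi> \<in> carrier_vec d" and i: "i \<in> {1..M}"
  shows "trig2 (fidelity \<xi> \<psi>) i"
  unfolding trig2_def
proof
  fix \<phi>
  obtain A B where AB: "A \<in> carrier_mat d d" "B \<in> carrier_mat d d" and
    U: "\<And>x. U (\<phi>(i := x)) M = complex_of_real (cos x) \<cdot>\<^sub>m A + complex_of_real (sin x) \<cdot>\<^sub>m B"
    using U_trig[OF i, of \<phi>] by auto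
  define \<alpha> \<beta> where "\<alpha> = \<xi> \<bullet>c (A *\<^sub>v \<psi>)" and "\<beta> = \<xi> \<bullet>c (B *\<^sub>v \<psi>)"
  have vecs: "A *\<^sub>v \<psi> \<in> carrier_vec d" "B *\<^sub>v \<psi> \<in> carrier_vec d" using AB \<psi> by auto
  have "fidelity \<xi> \<psi> (\<phi>(i := x)) = (cmod \<alpha> ^ 2 + cmod \<beta> ^ 2) / 2 + (cmod \<alpha> ^ 2 - cmod \<beta> ^ 2) / 2 * cos (2 * x)
      + Re (\<alpha> * cnj \<beta>) * sin (2 * x)" for x
  proof -
    have "U (\<phi>(i := x)) M *\<^sub>v \<psi> = complex_of_real (cos x) \<cdot>\<^sub>v (A *\<^sub>v \<psi>) + complex_of_real (sin x) \<cdot>\<^sub>v (B *\<^sub>v \<psi>)"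
      unfolding U using AB \<psi> by (simp add: add_mult_distrib_mat_vec[of _ d d] smult_mat_mult_vec[of _ d d])
    then have "\<xi> \<bullet>c (U (\<phi>(i := x)) M *\<^sub>v \<psi>) = complex_of_real (cos x) * \<alpha> + complex_of_real (sin x) * \<beta>"
      using \<xi> vecs by (simp add: cscalar_prod_add[of _ d] cscalar_prod_smult[of _ d] \<alpha>_def \<beta>_def)
    then have "fidelity \<xi> \<psi> (\<phi>(i := x)) = (cos x)\<^sup>2 * (cmod \<alpha>)\<^sup>2 + (sin x)\<^sup>2 * (cmod \<beta>)\<^sup>2
        + 2 * sin x * cos x * Re (\<alpha> * cnj \<beta>)"
      by (simp add: fidelity_def cmod_power2) (simp add: algebra_simps power2_eq_square)
    moreover have "(cos x)\<^sup>2 = (1 + cos (2 * x)) / 2" "(sin x)\<^sup>2 = (1 - cos (2 * x)) / 2"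
      by (simp_all add: cos_double_cos sin_squared_eq)
    moreover have "sin (2 * x) = 2 * sin x * cos x" by (rule sin_double)
    ultimately show ?thesis by (simp only:) (simp add: field_simps)
  qed
  then show "\<exists>A B C. \<forall>x. fidelity \<xi> \<psi> (\<phi>(i := x)) = A + B * cos (2 * x) + C * sin (2 * x)"
    by blast
qed

lemma fidelity_bounds:
  assumes \<xi>: "\<xi> \<in> carrier_vec d" "vnorm \<xi> = 1" and \<psi>: "\<psi> \<in> carrier_vec d" "vnorm \<psi> = 1"
  shows "0 \<le> fidelity \<xi> \<psi> \<phi>" "fidelity \<xi> \<psi> \<phi> \<le> 1"
proof -
  have "cmod (\<xi> \<bullet>c (U \<phi> M *\<^sub>v \<psi>)) \<le> vnorm \<xi> * vnorm (U \<phi> M *\<^sub>v \<psi>)"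
    using \<xi> \<psi> U_carrier[of M \<phi>] by (intro cscalar_prod_Cauchy_Schwarz[of _ d]) auto
  then have "cmod (\<xi> \<bullet>c (U \<phi> M *\<^sub>v \<psi>)) \<le> 1"
    using isometry_vnorm[OF U_isometry \<psi>(1)] \<xi> \<psi> by simp
  then show "fidelity \<xi> \<psi> \<phi> \<le> 1" by (simp add: fidelity_def power_le_one)
qed (simp add: fidelity_def)

text \<open>With \<open>u = U \<phi> M *\<^sub>v \<psi>\<close> and \<open>w = U \<phi> M *\<^sub>v (\<sigma> 1 *\<^sub>v \<psi>)\<close>, the two fidelities are the squared moduli of the
  inner products of \<open>T *\<^sub>v u\<close> with \<open>u\<close> and \<open>w\<close>.\<close>

lemma fidelity_gap:
  fixes \<phi> :: "nat \<Rightarrow> real"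
  assumes M: "1 \<le> M" and T: "isometry d T" and \<psi>: "\<psi> \<in> carrier_vec d" "vnorm \<psi> = 1"
    and e: "\<And>v. v \<in> carrier_vec d \<Longrightarrow> vnorm (T *\<^sub>v v - v) \<le> e * vnorm v"
  defines "\<xi> \<equiv> T *\<^sub>v (U \<phi> M *\<^sub>v \<psi>)"
  shows "fidelity \<xi> \<psi> \<phi> - fidelity \<xi> \<psi> (\<phi>(1 := \<phi> 1 + pi / 2)) \<ge> 1 - (cmod (\<psi> \<bullet>c (\<sigma> 1 *\<^sub>v \<psi>)))\<^sup>2 - 2 * e - 2 * e\<^sup>2"
proof -
  have 1: "1 \<in> {1..M}" using M by auto
  note s = sigma[OF 1]
  have Uc: "U \<phi> M \<in> carrier_mat d d" and Ui: "isometry d (U \<phi> M)"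
    using U_carrier U_isometry by auto
  define u w where "u = U \<phi> M *\<^sub>v \<psi>" and "w = U \<phi> M *\<^sub>v (\<sigma> 1 *\<^sub>v \<psi>)"
  have s\<psi>: "\<sigma> 1 *\<^sub>v \<psi> \<in> carrier_vec d" using s \<psi> by auto
  have u: "u \<in> carrier_vec d" and w: "w \<in> carrier_vec d" using Uc \<psi> s\<psi> by (auto simp: u_def w_def)
  have Tc: "T \<in> carrier_mat d d" using T by (simp add: isometry_def)
  have Tu: "T *\<^sub>v u \<in> carrier_vec d" using Tc u by auto
  have nu: "vnorm u = 1" unfolding u_def using isometry_vnorm[OF Ui \<psi>(1)] \<psi>(2) by simp
  have nw: "vnorm w = 1" unfolding w_def
    using isometry_vnorm[OF Ui s\<psi>] isometry_vnorm[OF sigma_isometry[OF 1] \<psi>(1)] \<psi>(2) by simp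
  have e': "vnorm (T *\<^sub>v u - u) \<le> e" using e[OF u] nu by simp
  then have e0: "e \<ge> 0" using vnorm_sq(3)[of "T *\<^sub>v u - u"] by linarith
  define p where "p = (T *\<^sub>v u) \<bullet>c u"
  \<comment> \<open>Expanding the squared norm of \<open>T *\<^sub>v u - u\<close> gives
    \<open>2 - 2 * Re p \<le> e\<^sup>2\<close>. The tangent bound
    \<open>2 * Re p - 1 \<le> (Re p)\<^sup>2\<close> then replaces squaring, so the sign of
    \<open>Re p\<close> does not matter.\<close>
  have "1 - e\<^sup>2 \<le> (cmod p)\<^sup>2"
  proof -
    have "complex_of_real ((vnorm (T *\<^sub>v u - u))\<^sup>2) = (T *\<^sub>v u) \<bullet>c (T *\<^sub>v u) - p - (cnj p - u \<bullet>c u)"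
      unfolding vnorm_sq(2)[symmetric] using Tu u cscalar_prod_cnj[OF Tu u]
      by (simp add: cscalar_prod_add[of _ d] p_def)
    also have "\<dots> = 2 - (p + cnj p)"
      using vnorm_sq(2)[of u] vnorm_sq(2)[of "T *\<^sub>v u"] nu isometry_vnorm[OF T u] by simp
    finally have "complex_of_real ((vnorm (T *\<^sub>v u - u))\<^sup>2) = complex_of_real (2 - 2 * Re p)"
      by (simp add: complex_add_cnj)
    then have "(vnorm (T *\<^sub>v u - u))\<^sup>2 = 2 - 2 * Re p" by (simp only: of_real_eq_iff)
    moreover have "(vnorm (T *\<^sub>v u - u))\<^sup>2 \<le> e\<^sup>2" using e' vnorm_sq(3) by (intro power_mono) auto
    moreover have "2 * Re p - 1 \<le> (Re p)\<^sup>2" using zero_le_power2[of "Re p - 1"]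
      by (simp add: power2_eq_square algebra_simps)
    moreover have "(Re p)\<^sup>2 \<le> (cmod p)\<^sup>2" by (simp add: cmod_power2)
    ultimately show ?thesis by linarith
  qed
  then have p: "1 - e\<^sup>2 \<le> fidelity \<xi> \<psi> \<phi>" by (simp add: fidelity_def \<xi>_def p_def u_def)
  have uw: "u \<bullet>c w = \<psi> \<bullet>c (\<sigma> 1 *\<^sub>v \<psi>)"
    using Ui \<psi>(1) s\<psi> by (simp add: isometry_def u_def w_def)
  have "fidelity \<xi> \<psi> (\<phi>(1 := \<phi> 1 + pi / 2)) = (cmod ((T *\<^sub>v u) \<bullet>c w))\<^sup>2"
  proof -
    have "U (\<phi>(1 := \<phi> 1 + pi / 2)) M *\<^sub>v \<psi> = (- \<i>) \<cdot>\<^sub>v w"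
      unfolding U_shift[OF M order_refl] w_def using Uc s \<psi> s\<psi>
      by (simp add: assoc_mult_mat_vec[of _ d d _ d] smult_mat_mult_vec[of _ d d] mult_mat_vec[of _ d d])
    then show ?thesis
      using Tu w by (simp add: fidelity_def \<xi>_def u_def[symmetric] cscalar_prod_smult[of _ d] norm_mult)
  qed
  \<comment> \<open>Replacing \<open>T *\<^sub>v u\<close> by \<open>u\<close> costs at most
    \<open>e\<close> in modulus; in the square, the mixed term is at most \<open>2 * e\<close>
    because \<open>u\<close> and \<open>w\<close> are unit vectors.\<close>
  also have "\<dots> \<le> (cmod (u \<bullet>c w))\<^sup>2 + 2 * e + e\<^sup>2"
  proof -
    have "(T *\<^sub>v u) \<bullet>c w = u \<bullet>c w + (T *\<^sub>v u - u) \<bullet>c w"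
      using Tu u w by (simp add: cscalar_prod_add[of _ d])
    then have "cmod ((T *\<^sub>v u) \<bullet>c w) \<le> cmod (u \<bullet>c w) + cmod ((T *\<^sub>v u - u) \<bullet>c w)"
      by (metis norm_triangle_ineq)
    also have "cmod ((T *\<^sub>v u - u) \<bullet>c w) \<le> e"
      using cscalar_prod_Cauchy_Schwarz[of "T *\<^sub>v u - u" d w] Tu u w nw e' by simp
    finally have "(cmod ((T *\<^sub>v u) \<bullet>c w))\<^sup>2 \<le> (cmod (u \<bullet>c w) + e)\<^sup>2"
      by (intro power_mono) auto
    also have "\<dots> = (cmod (u \<bullet>c w))\<^sup>2 + 2 * (cmod (u \<bullet>c w) * e) + e\<^sup>2"
      by (simp add: power2_sum)
    also have "cmod (u \<bullet>c w) * e \<le> 1 * e"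
      using cscalar_prod_Cauchy_Schwarz[OF u w] nu nw e0 by (intro mult_right_mono) auto
    finally show ?thesis by simp
  qed
  finally show ?thesis using p unfolding uw by linarith
qed

end

section \<open>From the cost and the trace to inner products; the final estimate\<close>

lemma braket_adjoint:
  assumes "U \<in> carrier_mat d d" "T \<in> carrier_mat d d" "V \<in> carrier_mat d d" "\<psi> \<in> carrier_vec d"
  shows "braket \<psi> (mat_adjoint U * T * V) \<psi> = (T *\<^sub>v (V *\<^sub>v \<psi>)) \<bullet>c (U *\<^sub>v \<psi>)"
proof -
  let ?x = "T *\<^sub>v (V *\<^sub>v \<psi>)"
  have x: "?x \<in> carrier_vec d" using assms by auto
  have U': "mat_adjoint U \<in> carrier_mat d d" using assms by simp
  have "mat_adjoint U * T * V *\<^sub>v \<psi> = mat_adjoint U *\<^sub>v ?x"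
    using assms(2-) assoc_mult_mat_vec[OF mult_carrier_mat[OF U' assms(2)] assms(3,4)]
      assoc_mult_mat_vec[OF U' assms(2), of "V *\<^sub>v \<psi>"]
    by simp
  then have "braket \<psi> (mat_adjoint U * T * V) \<psi> = (mat_adjoint U *\<^sub>v ?x) \<bullet>c \<psi>"
    by (simp add: braket_def)
  also have "\<dots> = cnj (\<psi> \<bullet>c (mat_adjoint U *\<^sub>v ?x))"
    by (rule cscalar_prod_cnj[OF assms(4) mult_mat_vec_carrier[OF U' x]])
  also have "\<dots> = cnj ((U *\<^sub>v \<psi>) \<bullet>c ?x)"
    by (simp add: cscalar_prod_mult_mat_vec[OF assms(1,4) x])
  also have "\<dots> = ?x \<bullet>c (U *\<^sub>v \<psi>)"
    using assms x by (intro cscalar_prod_cnj[of _ d, symmetric]) auto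
  finally show ?thesis .
qed

text \<open>On rank-one projections the trace factors into the square of the expectation of
  \<open>S\<close>, which is real as \<open>S\<close> is self-adjoint. This identifies
  \<open>a\<close> with the mean of the overlaps that occur in \<open>fidelity_gap\<close>.\<close>

lemma mtrace_proj:
  assumes S: "S \<in> carrier_mat d d" and adj: "mat_adjoint S = S" and \<psi>: "\<psi> \<in> carrier_vec d"
  shows "mtrace (S * proj \<psi> * S * proj \<psi>) = complex_of_real ((cmod (\<psi> \<bullet>c (S *\<^sub>v \<psi>)))\<^sup>2)"
proof -
  let ?v = "S *\<^sub>v \<psi>"
  have v: "?v \<in> carrier_vec d" using S \<psi> by auto
  have P: "proj \<psi> \<in> carrier_mat d d" using \<psi> by (auto simp: proj_def)
  have SP: "S * proj \<psi> \<in> carrier_mat d d" using S P by auto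
  have SPi: "(S * proj \<psi>) $$ (i, j) = vec_index ?v i * cnj (vec_index \<psi> j)" if "i < d" "j < d" for i j
    unfolding mult_mat_sum[OF S P that] mult_mat_vec_sum[OF S \<psi> that(1)]
    using that \<psi> by (simp add: proj_def sum_distrib_left mult_ac)
  have "S * proj \<psi> * S * proj \<psi> = (S * proj \<psi>) * (S * proj \<psi>)"
    using S P by (simp add: assoc_mult_mat[of _ d d _ d _ d])
  then have "mtrace (S * proj \<psi> * S * proj \<psi>) = (\<Sum>i<d. ((S * proj \<psi>) * (S * proj \<psi>)) $$ (i, i))"
    using S by (simp add: mtrace_def)
  also have "\<dots> = (\<Sum>i<d. \<Sum>j<d. (vec_index ?v i * cnj (vec_index \<psi> j)) * (vec_index ?v j * cnj (vec_index \<psi> i)))"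
    by (intro sum.cong refl) (simp add: mult_mat_sum[OF SP SP] SPi del: index_mult_mat index_mult_mat_vec)
  also have "\<dots> = (?v \<bullet>c \<psi>) * (?v \<bullet>c \<psi>)"
    unfolding cscalar_prod_sum[OF \<psi>] sum_product by (simp add: mult_ac del: index_mult_mat_vec)
  also have "\<dots> = (\<psi> \<bullet>c ?v) * cnj (\<psi> \<bullet>c ?v)"
    using cscalar_prod_mult_mat_vec[OF S \<psi> \<psi>] cscalar_prod_cnj[OF \<psi> v] by (simp add: adj)
  finally show ?thesis by (simp only: complex_norm_square)
qed

theorem theorem2:
  fixes n M :: nat
    and H :: "complex mat"
    and \<psi>0 \<psi>1 :: "complex Matrix.vec"
    and \<sigma> W :: "nat \<Rightarrow> complex mat"
    and \<phi>bar :: "nat \<Rightarrow> real"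
    and dt r r0 :: real
  defines "d \<equiv> 2 ^ n"
  defines "a \<equiv> Re (1/3 * (\<Sum>\<psi>\<leftarrow>[\<psi>0, \<psi>1, psi_plus \<psi>0 \<psi>1].
                   mtrace (\<sigma> 1 * proj \<psi> * \<sigma> 1 * proj \<psi>)))"
  defines "Em \<equiv> max_abs_eig H"
  defines "b \<equiv> 1 - a - 2 * Em * dt - 2 * Em\<^sup>2 * dt\<^sup>2"
  assumes H: "H \<in> carrier_mat d d" "hermitian H" "H \<noteq> 0\<^sub>m d d"
    and psi: "\<psi>0 \<in> carrier_vec d" "\<psi>1 \<in> carrier_vec d"
      "\<psi>0 \<bullet>c \<psi>0 = 1" "\<psi>1 \<bullet>c \<psi>1 = 1" "\<psi>0 \<bullet>c \<psi>1 = 0"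
    and sigma: "\<forall>i\<in>{1..M}. pauli_string n (\<sigma> i)"
    and W: "\<forall>i\<in>{1..M}. W i \<in> carrier_mat d d \<and> unitary (W i)"
    and M: "M \<ge> 2"
    and dt: "0 < dt" "dt < (sqrt (3 - 2 * a) - 1) / (2 * Em)"
    and r0: "0 < r0" "r0 < 1"
    and r: "0 < r" "r\<^sup>2 \<le> 3 * r0\<^sup>2 / (real M - 1) * (b / (1 + b))"
  shows "variance_of (hypercube_unif M \<phi>bar r) (cost d M \<sigma> W H dt \<psi>0 \<psi>1 \<phi>bar)
           \<ge> 4 * r ^ 4 / 45 * (1 - 4 * r\<^sup>2 / 7) * (1 - r0\<^sup>2)\<^sup>2 * b\<^sup>2"
proof -
  interpret circuit d M \<sigma> W
    using sigma W by unfold_locales (auto simp: d_def intro: pauli_string[of n] isometry_unitary)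
  have one: "1 \<in> {1..M}" using M by auto
  define e where "e = Em * dt"
  define T where "T = time_evol H dt"
  have T: "isometry d T" and Tv: "\<And>v. v \<in> carrier_vec d \<Longrightarrow> vnorm (T *\<^sub>v v - v) \<le> e * vnorm v"
    using time_evol_hermitian[OF H(1,2), of dt] dt(1) by (auto simp: T_def e_def Em_def)
  have Tc: "T \<in> carrier_mat d d" using T by (simp add: isometry_def)
  define \<Psi> where "\<Psi> = [\<psi>0, \<psi>1, psi_plus \<psi>0 \<psi>1]"
  have \<psi>10: "\<psi>1 \<bullet>c \<psi>0 = 0" using cscalar_prod_cnj[OF psi(1,2)] psi(5) by simp
  have plus: "psi_plus \<psi>0 \<psi>1 \<in> carrier_vec d" using psi by (auto simp: psi_plus_def)
  have "psi_plus \<psi>0 \<psi>1 \<bullet>c psi_plus \<psi>0 \<psi>1 = 1"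
  proof -
    define c where "c = complex_of_real (1 / sqrt 2)"
    have c: "c * c * 2 = 1" unfolding c_def of_real_mult[symmetric] by simp
    have "(c \<cdot>\<^sub>v (\<psi>0 + \<psi>1)) \<bullet>c (c \<cdot>\<^sub>v (\<psi>0 + \<psi>1)) = c * (cnj c * 2)"
      using psi \<psi>10 by (simp add: cscalar_prod_add[of _ d] cscalar_prod_smult[of _ d])
    then show ?thesis using c by (simp add: psi_plus_def c_def)
  qed
  then have unit: "\<psi> \<in> carrier_vec d" "vnorm \<psi> = 1" if "\<psi> \<in> set \<Psi>" for \<psi>
    using that psi plus by (auto simp: \<Psi>_def vnorm_def)
  define \<xi> where "\<xi> \<psi> = T *\<^sub>v (U \<phi>bar M *\<^sub>v \<psi>)" for \<psi>
  have Ub: "U \<phi>bar M \<in> carrier_mat d d" by (rule U_carrier) simp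
  have \<xi>: "\<xi> \<psi> \<in> carrier_vec d" "vnorm (\<xi> \<psi>) = 1" if "\<psi> \<in> set \<Psi>" for \<psi>
  proof -
    have u: "U \<phi>bar M *\<^sub>v \<psi> \<in> carrier_vec d" using Ub unit[OF that] by auto
    show "\<xi> \<psi> \<in> carrier_vec d" using Tc u by (auto simp: \<xi>_def)
    show "vnorm (\<xi> \<psi>) = 1"
      using isometry_vnorm[OF T u] isometry_vnorm[OF U_isometry unit(1)[OF that], of M \<phi>bar] unit(2)[OF that]
      by (simp add: \<xi>_def)
  qed
  define F where "F \<phi> = 1 / 3 * (\<Sum>\<psi>\<leftarrow>\<Psi>. fidelity (\<xi> \<psi>) \<psi> \<phi>)" for \<phi>
  have F_eq: "F \<phi> = 1 / 3 * (fidelity (\<xi> \<psi>0) \<psi>0 \<phi> + (fidelity (\<xi> \<psi>1) \<psi>1 \<phi>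
      + fidelity (\<xi> (psi_plus \<psi>0 \<psi>1)) (psi_plus \<psi>0 \<psi>1) \<phi>))" for \<phi>
    by (simp add: F_def \<Psi>_def)
  have mem: "\<psi>0 \<in> set \<Psi>" "\<psi>1 \<in> set \<Psi>" "psi_plus \<psi>0 \<psi>1 \<in> set \<Psi>" by (auto simp: \<Psi>_def)
  have cost: "cost d M \<sigma> W H dt \<psi>0 \<psi>1 \<phi>bar = (\<lambda>\<phi>. 1 - F \<phi>)"
  proof
    fix \<phi>
    have "(cmod (braket \<psi> (mat_adjoint (U \<phi> M) * T * U \<phi>bar M) \<psi>))\<^sup>2 = fidelity (\<xi> \<psi>) \<psi> \<phi>" if "\<psi> \<in> set \<Psi>" for \<psi>
      using braket_adjoint[OF U_carrier[OF order_refl] Tc Ub unit(1)[OF that], of \<phi>]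
      by (simp add: fidelity_def \<xi>_def)
    then show "cost d M \<sigma> W H dt \<psi>0 \<psi>1 \<phi>bar \<phi> = 1 - F \<phi>"
      unfolding cost_def F_eq T_def[symmetric] using mem by (simp add: field_simps)
  qed
  have Fm: "F \<in> borel_measurable (PiM {1..M} (\<lambda>_. borel))"
    unfolding F_eq[abs_def]
    by (intro borel_measurable_times borel_measurable_add borel_measurable_const measurable_fidelity \<xi> unit mem)
  have Ft: "trig2 F i" if "i \<in> {1..M}" for i
    unfolding F_eq[abs_def] by (intro trig2_cmult trig2_add trig2_fidelity \<xi> unit mem that)
  have F01: "0 \<le> F \<phi>" "F \<phi> \<le> 1" for \<phi>
    using fidelity_bounds[OF \<xi> unit, OF mem(1) mem(1) mem(1) mem(1), of \<phi>]
      fidelity_bounds[OF \<xi> unit, OF mem(2) mem(2) mem(2) mem(2), of \<phi>]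
      fidelity_bounds[OF \<xi> unit, OF mem(3) mem(3) mem(3) mem(3), of \<phi>]
    by (auto simp: F_eq)
  have a: "a = 1 / 3 * ((cmod (\<psi>0 \<bullet>c (\<sigma> 1 *\<^sub>v \<psi>0)))\<^sup>2 + ((cmod (\<psi>1 \<bullet>c (\<sigma> 1 *\<^sub>v \<psi>1)))\<^sup>2
      + (cmod (psi_plus \<psi>0 \<psi>1 \<bullet>c (\<sigma> 1 *\<^sub>v psi_plus \<psi>0 \<psi>1)))\<^sup>2))"
  proof -
    have "mtrace (\<sigma> 1 * proj \<psi> * \<sigma> 1 * proj \<psi>) = complex_of_real ((cmod (\<psi> \<bullet>c (\<sigma> 1 *\<^sub>v \<psi>)))\<^sup>2)"
      if "\<psi> \<in> set \<Psi>" for \<psi>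
      using circuit.sigma[OF circuit_axioms one] sigma_adj[OF one] unit(1)[OF that] by (rule mtrace_proj)
    note tr = this[OF mem(1)] this[OF mem(2)] this[OF mem(3)]
    show ?thesis
      unfolding a_def list.map sum_list.Cons sum_list.Nil tr by simp
  qed
  have be: "b = 1 - a - 2 * e - 2 * e\<^sup>2" by (simp add: b_def e_def power_mult_distrib)
  have gap: "F \<phi>bar - F (\<phi>bar(1 := \<phi>bar 1 + pi / 2)) \<ge> b"
  proof -
    have "fidelity (\<xi> \<psi>) \<psi> \<phi>bar - fidelity (\<xi> \<psi>) \<psi> (\<phi>bar(1 := \<phi>bar 1 + pi / 2))
        \<ge> 1 - (cmod (\<psi> \<bullet>c (\<sigma> 1 *\<^sub>v \<psi>)))\<^sup>2 - 2 * e - 2 * e\<^sup>2" if "\<psi> \<in> set \<Psi>" for \<psi>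
      unfolding \<xi>_def by (rule fidelity_gap[OF _ T unit[OF that] Tv]) (use M in auto)
    note gaps = this[OF mem(1)] this[OF mem(2)] this[OF mem(3)]
    have "1 - 1 / 3 * (x + (y + z)) - 2 * e - 2 * e\<^sup>2 \<le> 1 / 3 * (p + (q + s)) - 1 / 3 * (p' + (q' + s'))"
      if "1 - x - 2 * e - 2 * e\<^sup>2 \<le> p - p'" "1 - y - 2 * e - 2 * e\<^sup>2 \<le> q - q'" "1 - z - 2 * e - 2 * e\<^sup>2 \<le> s - s'"
      for x y z p q s p' q' s' :: real
      using that by (simp add: field_simps)
    from this[OF gaps] show ?thesis unfolding F_eq be a .
  qed
  \<comment> \<open>The centre of the cube is \<open>undefined\<close> off the index set, whereas
    \<open>\<phi>bar\<close> is arbitrary there; the circuit reads only the coordinates from 1 to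
    \<open>M\<close>.\<close>
  have F_cong: "F \<phi> = F \<phi>'" if "\<And>i. i \<in> {1..M} \<Longrightarrow> \<phi> i = \<phi>' i" for \<phi> \<phi>'
    unfolding F_def fidelity_def using U_cong[of M \<phi> \<phi>'] that by simp

  have Em: "Em > 0"
  proof -
    obtain k where "k \<in> spectrum H" using spectrum_non_empty[OF H(1)] by (auto simp: d_def)
    then have "Em \<ge> 0" using max_abs_eig_ge[OF H(1)] norm_ge_zero order_trans unfolding Em_def by blast
    \<comment> \<open>For \<open>Em = 0\<close> the upper bound on \<open>dt\<close> would be a
      quotient by 0, which is 0, contradicting \<open>0 < dt\<close>.\<close>
    moreover have "Em \<noteq> 0" using dt by auto
    ultimately show ?thesis by simp
  qed
  \<comment> \<open>The threshold for \<open>dt\<close> is this condition solved for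
    \<open>dt\<close>: \<open>3 - 2 * a - (1 + 2 * e)\<^sup>2\<close> equals
    \<open>2 * b\<close>.\<close>
  have b: "b > 0"
  proof -
    have "1 + 2 * e < sqrt (3 - 2 * a)" using dt(2) Em by (simp add: e_def field_simps)
    moreover have "e > 0" using Em dt(1) by (simp add: e_def)
    ultimately have "(1 + 2 * e)\<^sup>2 < (sqrt (3 - 2 * a))\<^sup>2" by (intro power_strict_mono) auto
    \<comment> \<open>The real \<open>sqrt\<close> is negative on negative arguments, so a positive
      root fixes the sign.\<close>
    moreover have "3 - 2 * a \<ge> 0"
      using \<open>1 + 2 * e < sqrt (3 - 2 * a)\<close> \<open>e > 0\<close> real_sqrt_lt_0_iff[of "3 - 2 * a"] by linarith
    ultimately have "(1 + 2 * e)\<^sup>2 < 3 - 2 * a" by simp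
    then show ?thesis by (simp add: be power2_eq_square algebra_simps)
  qed
  define x where "x = r\<^sup>2 / 3"
  define N where "N = real (M - 1)"
  have N: "N \<ge> 1" "real M - 1 = N" using M by (auto simp: N_def)
  have x0: "x > 0" using r(1) by (simp add: x_def)
  have xb: "N * x * (1 + b) \<le> r0\<^sup>2 * b"
  proof -
    have pos: "N * (1 + b) > 0" using N b by simp
    have "r\<^sup>2 \<le> 3 * r0\<^sup>2 * b / (N * (1 + b))" using r(2) by (simp add: N)
    then have "r\<^sup>2 * (N * (1 + b)) \<le> 3 * r0\<^sup>2 * b" by (simp only: pos_le_divide_eq[OF pos])
    then show ?thesis by (simp add: x_def algebra_simps)
  qed
  have r01: "r0\<^sup>2 < 1" using r0 by (simp add: power_less_one_iff)
  \<comment> \<open>From \<open>r0\<^sup>2 * b \<le> 1 + b\<close>. It yields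
    \<open>x \<le> 1\<close>, needed both for Bernoulli's inequality and for
    \<open>r\<^sup>2 \<le> 3\<close>.\<close>
  have Nx: "N * x \<le> 1"
  proof -
    have "r0\<^sup>2 * b \<le> 1 * b" using r01 b by (intro mult_right_mono) auto
    with xb have "N * x * (1 + b) \<le> 1 * (1 + b)" by simp
    then show ?thesis using b by (simp only: mult_le_cancel_right)
  qed
  have "1 * x \<le> N * x" using N x0 by (intro mult_right_mono) auto
  then have "x \<le> 1" using Nx by linarith
  then have r3: "r\<^sup>2 \<le> 3" by (simp add: x_def)
  let ?m = "(1 - r0\<^sup>2) * b"
  have m0: "0 \<le> ?m" using r01 b by simp
  \<comment> \<open>By Bernoulli the right-hand side is at least
    \<open>(1 - N * x) * (1 + b) - 1 = b - N * x * (1 + b)\<close>, and \<open>xb\<close> bounds the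
    subtracted term by \<open>r0\<^sup>2 * b\<close>.\<close>
  have m1: "?m \<le> (1 - r\<^sup>2 / 3) ^ card {2..M} * (1 + b) - 1"
  proof -
    have "1 - N * x \<le> (1 - x) ^ (M - 1)"
      using Bernoulli_inequality[of "- x" "M - 1"] \<open>x \<le> 1\<close> by (simp add: N_def)
    then have "(1 - N * x) * (1 + b) \<le> (1 - x) ^ (M - 1) * (1 + b)"
      using b by (intro mult_right_mono) auto
    moreover have "?m + 1 \<le> (1 - N * x) * (1 + b)" using xb by (simp add: algebra_simps)
    moreover have card: "card {2..M} = M - 1" by simp
    ultimately show ?thesis unfolding card x_def[symmetric] by linarith
  qed
  have ins: "insert 1 {2..M} = {1..M}" using M by auto
  have "var_cos r * (?m / 2)\<^sup>2 \<le> variance_of (PiM (insert 1 {2..M}) (\<lambda>j. centered (\<phi>bar j) r)) (\<lambda>\<phi>. 1 - F \<phi>)"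
  proof (rule variance_PiM_centered_trig2_ge[where b = b])
    have "F ((restrict \<phi>bar {2..M})(1 := \<phi>bar 1)) = F \<phi>bar"
      "F ((restrict \<phi>bar {2..M})(1 := \<phi>bar 1 + pi / 2)) = F (\<phi>bar(1 := \<phi>bar 1 + pi / 2))"
      by (rule F_cong; auto)+
    then show "b \<le> F ((restrict \<phi>bar {2..M})(1 := \<phi>bar 1)) - F ((restrict \<phi>bar {2..M})(1 := \<phi>bar 1 + pi / 2))"
      using gap by simp
    show "trig2 F j" if "j \<in> insert 1 {2..M}" for j
      using that unfolding ins by (rule Ft)
  qed (use r(1) r3 m0 m1 F01 Fm in \<open>auto simp only: ins\<close>, auto)
  moreover have "4 * r ^ 4 / 45 * (1 - 4 * r\<^sup>2 / 7) * (1 - r0\<^sup>2)\<^sup>2 * b\<^sup>2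
      = 16 * r ^ 4 / 45 * (1 - 4 * r\<^sup>2 / 7) * (?m / 2)\<^sup>2"
    by (simp add: power_divide power_mult_distrib)
  moreover have "\<dots> \<le> var_cos r * (?m / 2)\<^sup>2"
    using var_cos_ge[OF r(1)] by (intro mult_right_mono) auto
  ultimately show ?thesis
    unfolding cost hypercube_unif_def ins by linarith
qed

end
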